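(* Let $\mathbf{x}:U\to\mathbb{R}^3$ be a proper wavefront and $\mathbf{\Omega}$ a tangent moving basis of $\mathbf{x}$. If the Gaussian curvature is extendable and the extension is strictly negative, then locally at a singularity $p$ there exist open sets $U_1,U_2$ of $\mathbb{R}^2$ with $p\in U_2$, $U_2\subset U$, and a diffeomorphism $\mathbf{t}:U_1\to U_2$ such that the coordinate curves (the images under $\mathbf{t}$ of the segments in $U_1$ parallel to the coordinate axes) are G-asymptotic curves of $\mathbf{x}$.
   Context: All maps are $C^\infty$ and $U\subset\mathbb{R}^2$ is open. $D$ denotes the Jacobian matrix. A tangent moving basis (tmb) of $\mathbf{x}:U\to\mathbb{R}^3$ is a smooth map $\mathbf{\Omega}=(\mathbf{w}_1\ \mathbf{w}_2):U\to\mathcal{M}_{3\times2}(\mathbb{R})$ with columns linearly independent at every point and $\mathbf{x}_u,\mathbf{x}_v\in\mathrm{span}(\mathbf{w}_1,\mathbf{w}_2)$. The map $\mathbf{x}$ is a frontal if near each point $p$ there is a smooth unit vector field $\mathbf{n}_p$ orthogonal to $\mathbf{x}_u,\mathbf{x}_v$ (equivalently, tmbs exist locally; a global tmb is always assumed), and a wavefront if moreover each $(\mathbf{x},\mathbf{n}_p)$ is an immersion into $\mathbb{R}^3\times S^2$. The normal field induced by $\mathbf{\Omega}$ is $\mathbf{n}=\frac{\mathbf{w}_1\times\mathbf{w}_2}{\|\mathbf{w}_1\times\mathbf{w}_2\|}$. $\Sigma(\mathbf{x})$ is the set of singularities, i.e. points where $\mathbf{x}$ is not immersive; $\mathbf{x}$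 is proper if $\Sigma(\mathbf{x})$ has empty interior. Set $\mathbf{I}=D\mathbf{x}^TD\mathbf{x}$, $\mathbf{II}=-D\mathbf{x}^TD\mathbf{n}$. The Gaussian curvature on $\Sigma(\mathbf{x})^c$ is $K=\det\mathbf{II}/\det\mathbf{I}$; it is extendable if it has a smooth extension to $U$. A smooth curve $\gamma:J\to U$ ($J$ an open interval) is a Gaussian asymptotic (G-asymptotic) curve of $\mathbf{x}$ if $\gamma'(t)^T\,\mathbf{II}(\gamma(t))\,\gamma'(t)=0$ for all $t$. *)

theory Defs
  imports "HOL-Analysis.Analysis"
begin

text \<open>Differentiability classes are meant for open sets \<open>S\<close>: derivatives are taken in the ambient
  space. As the domain is finite-dimensional, it suffices to iterate directional derivatives.\<close>

primrec Ck_on :: "nat \<Rightarrow> 'a::euclidean_space set \<Rightarrow> ('a \<Rightarrow> 'b::real_normed_vector) \<Rightarrow> bool" where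
  "Ck_on 0 S f \<longleftrightarrow> continuous_on S f"
| "Ck_on (Suc k) S f \<longleftrightarrow>
     (\<forall>x\<in>S. f differentiable (at x)) \<and>
     (\<forall>v. Ck_on k S (\<lambda>x. frechet_derivative f (at x) v))"

definition smooth_on :: "'a::euclidean_space set \<Rightarrow> ('a \<Rightarrow> 'b::real_normed_vector) \<Rightarrow> bool" where
  "smooth_on S f \<longleftrightarrow> (\<forall>k. Ck_on k S f)"

definition diffeomorphism ::
  "'a::euclidean_space set \<Rightarrow> 'b::euclidean_space set \<Rightarrow> ('a \<Rightarrow> 'b) \<Rightarrow> bool" where
  "diffeomorphism S T f \<longleftrightarrow>
     bij_betw f S T \<and> smooth_on S f \<and> smooth_on T (inv_into S f)"

definition immersive_at :: "('a::real_normed_vector \<Rightarrow> 'b::real_normed_vector) \<Rightarrow> 'a \<Rightarrow> bool" where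
  "immersive_at f p \<longleftrightarrow> f differentiable (at p) \<and> inj (frechet_derivative f (at p))"

text \<open>The partial derivatives \<open>x\<^sub>u\<close>, \<open>x\<^sub>v\<close> are the columns of the Jacobian matrix of \<open>x\<close>.\<close>

definition tangent_moving_basis ::
  "(real^2) set \<Rightarrow> (real^2 \<Rightarrow> real^3) \<Rightarrow> (real^2 \<Rightarrow> real^2^3) \<Rightarrow> bool" where
  "tangent_moving_basis U x \<Omega> \<longleftrightarrow>
     smooth_on U \<Omega> \<and>
     (\<forall>p\<in>U. column 1 (\<Omega> p) \<noteq> column 2 (\<Omega> p) \<and>
            independent {column 1 (\<Omega> p), column 2 (\<Omega> p)} \<and>
            column 1 (jacobian x (at p)) \<in> span {column 1 (\<Omega> p), column 2 (\<Omega> p)} \<and>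
            column 2 (jacobian x (at p)) \<in> span {column 1 (\<Omega> p), column 2 (\<Omega> p)})"

definition unit_normal_field ::
  "(real^2) set \<Rightarrow> (real^2 \<Rightarrow> real^3) \<Rightarrow> (real^2 \<Rightarrow> real^3) \<Rightarrow> bool" where
  "unit_normal_field V x n \<longleftrightarrow>
     smooth_on V n \<and>
     (\<forall>q\<in>V. norm (n q) = 1 \<and>
            orthogonal (n q) (column 1 (jacobian x (at q))) \<and>
            orthogonal (n q) (column 2 (jacobian x (at q))))"

definition frontal :: "(real^2) set \<Rightarrow> (real^2 \<Rightarrow> real^3) \<Rightarrow> bool" where
  "frontal U x \<longleftrightarrow>
     smooth_on U x \<and>
     (\<forall>p\<in>U. \<exists>V n. open V \<and> p \<in> V \<and> V \<subseteq> U \<and> unit_normal_field V x n)"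

text \<open>A map into \<open>\<real>\<^sup>3 \<times> S\<^sup>2\<close> is an immersion iff it is one as a map into \<open>\<real>\<^sup>3 \<times> \<real>\<^sup>3\<close>.\<close>

definition wavefront :: "(real^2) set \<Rightarrow> (real^2 \<Rightarrow> real^3) \<Rightarrow> bool" where
  "wavefront U x \<longleftrightarrow>
     frontal U x \<and>
     (\<forall>p\<in>U. \<exists>V n. open V \<and> p \<in> V \<and> V \<subseteq> U \<and> unit_normal_field V x n \<and>
              (\<forall>q\<in>V. immersive_at (\<lambda>q. (x q, n q)) q))"

definition singularities :: "(real^2) set \<Rightarrow> (real^2 \<Rightarrow> real^3) \<Rightarrow> (real^2) set" where
  "singularities U x = {p \<in> U. \<not> immersive_at x p}"

definition proper_frontal :: "(real^2) set \<Rightarrow> (real^2 \<Rightarrow> real^3) \<Rightarrow> bool" where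
  "proper_frontal U x \<longleftrightarrow> interior (singularities U x) = {}"

definition induced_normal :: "(real^2 \<Rightarrow> real^2^3) \<Rightarrow> real^2 \<Rightarrow> real^3" where
  "induced_normal \<Omega> p =
     (let w = cross3 (column 1 (\<Omega> p)) (column 2 (\<Omega> p)) in w /\<^sub>R norm w)"

definition first_form :: "(real^2 \<Rightarrow> real^3) \<Rightarrow> real^2 \<Rightarrow> real^2^2" where
  "first_form x p = transpose (jacobian x (at p)) ** jacobian x (at p)"

definition second_form ::
  "(real^2 \<Rightarrow> real^3) \<Rightarrow> (real^2 \<Rightarrow> real^2^3) \<Rightarrow> real^2 \<Rightarrow> real^2^2" where
  "second_form x \<Omega> p = - (transpose (jacobian x (at p)) ** jacobian (induced_normal \<Omega>) (at p))"

text \<open>Only meaningful at points where \<open>x\<close> is immersive.\<close>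

definition gaussian_curvature ::
  "(real^2 \<Rightarrow> real^3) \<Rightarrow> (real^2 \<Rightarrow> real^2^3) \<Rightarrow> real^2 \<Rightarrow> real" where
  "gaussian_curvature x \<Omega> p = det (second_form x \<Omega> p) / det (first_form x p)"

definition gaussian_curvature_extension ::
  "(real^2) set \<Rightarrow> (real^2 \<Rightarrow> real^3) \<Rightarrow> (real^2 \<Rightarrow> real^2^3) \<Rightarrow> (real^2 \<Rightarrow> real) \<Rightarrow> bool" where
  "gaussian_curvature_extension U x \<Omega> \<kappa> \<longleftrightarrow>
     smooth_on U \<kappa> \<and> (\<forall>q \<in> U - singularities U x. \<kappa> q = gaussian_curvature x \<Omega> q)"

definition open_interval :: "real set \<Rightarrow> bool" where
  "open_interval J \<longleftrightarrow> J \<noteq> {} \<and> open J \<and> is_interval J"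

definition G_asymptotic ::
  "(real^2) set \<Rightarrow> (real^2 \<Rightarrow> real^3) \<Rightarrow> (real^2 \<Rightarrow> real^2^3) \<Rightarrow> real set \<Rightarrow> (real \<Rightarrow> real^2) \<Rightarrow> bool"
where
  "G_asymptotic U x \<Omega> J \<gamma> \<longleftrightarrow>
     open_interval J \<and> smooth_on J \<gamma> \<and> \<gamma> ` J \<subseteq> U \<and>
     (\<forall>s\<in>J. vector_derivative \<gamma> (at s) \<bullet>
              (second_form x \<Omega> (\<gamma> s) *v vector_derivative \<gamma> (at s)) = 0)"

definition coordinate_curves_G_asymptotic ::
  "(real^2) set \<Rightarrow> (real^2 \<Rightarrow> real^3) \<Rightarrow> (real^2 \<Rightarrow> real^2^3) \<Rightarrow>
   (real^2) set \<Rightarrow> (real^2 \<Rightarrow> real^2) \<Rightarrow> bool" where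
  "coordinate_curves_G_asymptotic U x \<Omega> U\<^sub>1 t \<longleftrightarrow>
     (\<forall>J c. open_interval J \<longrightarrow>
        ((\<forall>s\<in>J. vector [s, c] \<in> U\<^sub>1) \<longrightarrow> G_asymptotic U x \<Omega> J (\<lambda>s. t (vector [s, c]))) \<and>
        ((\<forall>s\<in>J. vector [c, s] \<in> U\<^sub>1) \<longrightarrow> G_asymptotic U x \<Omega> J (\<lambda>s. t (vector [c, s]))))"

end

theory Submission imports Defs begin

text \<open>Write \<open>n\<close> for the induced normal and \<open>\<delta> = sqrt (- \<kappa>)\<close>, a smooth positive function. At a regular point a
  direction \<open>w\<close> is asymptotic iff \<open>Dx w\<close> and \<open>Dn w\<close> are orthogonal; as both lie in the plane
  orthogonal to \<open>n\<close>, \<open>Dn w\<close> is then a multiple of \<open>n \<times> Dx w\<close>, and by the Beltrami-Enneper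
  theorem the factor is \<open>\<delta>\<close> or \<open>- \<delta>\<close>. The quadratic equation of the asymptotic directions thus
  splits into the two linear equations \<open>Dn w \<mp> \<delta> (n \<times> Dx w) = 0\<close>. These linear equations remain
  meaningful on the singular set, where the second fundamental form vanishes altogether.

  The proof shows that the two equations define transverse smooth line fields near a singularity \<open>p\<close>.
  Their left-hand sides have rank at most one at every point (\<open>asymptotic_form_rank\<close>): the
  determinant is the determinant of \<open>Dn\<close> minus \<open>\<kappa>\<close> times that of \<open>Dx\<close>, plus a term that vanishes by symmetry
  of the second fundamental form, and \<open>det Dn = \<kappa> det Dx\<close> extends by continuity from the dense set of
  regular points. At \<open>p\<close> the rank is not zero: otherwise a kernel vector of \<open>Dx\<close> would be one of \<open>Dn\<close>, which
  the wavefront property excludes (\<open>wavefront_kernel\<close>). The same property makes the two kernels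
  at \<open>p\<close> independent (\<open>asymptotic_forms_independent\<close>).

  Each line field is, near \<open>p\<close>, the kernel field of a first integral \<open>h\<close>
  (\<open>first_integral_of_covector_field\<close>). This is where a differential equation has to be solved with
  smooth dependence on the initial value (\<open>smooth_local_flow\<close>). The map \<open>H = (h\<^sub>1, h\<^sub>2)\<close> built from the two first
  integrals is a local diffeomorphism (\<open>smooth_inverse_function\<close>). Along a coordinate curve of its
  inverse \<open>t\<close> one of the first integrals is constant, so the curve is tangent to the corresponding
  line field and hence G-asymptotic.\<close>

section \<open>Calculus of iterated derivatives\<close>

text \<open>Unfolded by the simplifier, the recursive clause would descend into iterated derivatives.\<close>

declare Ck_on.simps(2) [simp del]

lemma Ck_on_subset: "Ck_on k S f \<Longrightarrow> T \<subseteq> S \<Longrightarrow> Ck_on k T f"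
  by (induction k arbitrary: f) (auto simp: Ck_on.simps(2) intro: continuous_on_subset)

lemma Ck_on_Suc_differentiable: "Ck_on (Suc k) S f \<Longrightarrow> x \<in> S \<Longrightarrow> f differentiable (at x)"
  by (simp add: Ck_on.simps)

lemma Ck_on_frechet_derivative:
  "Ck_on (Suc k) S f \<Longrightarrow> Ck_on k S (\<lambda>x. frechet_derivative f (at x) v)"
  by (simp add: Ck_on.simps)

lemma Ck_on_SucD: "Ck_on (Suc k) S f \<Longrightarrow> Ck_on k S f"
proof (induction k arbitrary: f)
  case 0
  have "isCont f x" if "x \<in> S" for x
    using Ck_on_Suc_differentiable[OF 0 that] by (rule differentiable_imp_continuous_within)
  then show ?case by (simp add: continuous_at_imp_continuous_on)
next
  case (Suc k)
  have "Ck_on k S (\<lambda>x. frechet_derivative f (at x) v)" for v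
    using Suc.prems by (intro Suc.IH Ck_on_frechet_derivative)
  moreover have "f differentiable (at x)" if "x \<in> S" for x
    using Suc.prems that by (rule Ck_on_Suc_differentiable)
  ultimately show ?case unfolding Ck_on.simps(2) by blast
qed

lemma Ck_on_imp_continuous_on: "Ck_on k S f \<Longrightarrow> continuous_on S f"
proof (induction k)
  case (Suc k)
  then show ?case using Ck_on_SucD by blast
qed simp

lemma Ck_on_transform:
  assumes "open S" "Ck_on k S f" "\<And>x. x \<in> S \<Longrightarrow> f x = g x"
  shows "Ck_on k S g"
  using assms(2,3)
proof (induction k arbitrary: f g)
  case 0
  then have "continuous_on S f" by (simp only: Ck_on.simps)
  then have "continuous_on S g" by (rule continuous_on_eq) (rule 0(2))
  then show ?case by (simp only: Ck_on.simps)
next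
  case (Suc k)
  let ?Df = "\<lambda>x. frechet_derivative f (at x)"
  have der: "(g has_derivative ?Df x) (at x)" if "x \<in> S" for x
    using Ck_on_Suc_differentiable[OF Suc.prems(1) that, unfolded frechet_derivative_works]
    by (rule has_derivative_transform_within_open[OF _ \<open>open S\<close> that Suc.prems(2)])
  have "Ck_on k S (\<lambda>x. frechet_derivative g (at x) v)" for v
    using Ck_on_frechet_derivative[OF Suc.prems(1)]
    by (rule Suc.IH) (simp add: frechet_derivative_at[OF der])
  with der show ?case unfolding Ck_on.simps(2) differentiable_def by blast
qed

lemma Ck_on_cong:
  assumes "open S" "\<And>x. x \<in> S \<Longrightarrow> f x = g x"
  shows "Ck_on k S f \<longleftrightarrow> Ck_on k S g"
  using Ck_on_transform[OF \<open>open S\<close>, of k f g] Ck_on_transform[OF \<open>open S\<close>, of k g f] assms(2) by auto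

text \<open>Any explicit formula for the derivative may be used in place of \<open>frechet_derivative\<close>. The closure
  properties below are proved by induction on \<open>k\<close> through this rule.\<close>

lemma Ck_on_SucI:
  assumes "open S" "\<And>x. x \<in> S \<Longrightarrow> (f has_derivative f' x) (at x)"
    and "\<And>v. Ck_on k S (\<lambda>x. f' x v)"
  shows "Ck_on (Suc k) S f"
proof -
  have "frechet_derivative f (at x) = f' x" if "x \<in> S" for x
    using assms(2)[OF that] by (rule frechet_derivative_at[symmetric])
  then have "Ck_on k S (\<lambda>x. frechet_derivative f (at x) v)" for v
    using assms(3)[of v] \<open>open S\<close> by (subst Ck_on_cong[where g = "\<lambda>x. f' x v"]) auto
  with assms(2) show ?thesis unfolding Ck_on.simps(2) differentiable_def by blast
qed

lemma Ck_on_Suc_has_derivative: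
  "Ck_on (Suc k) S f \<Longrightarrow> x \<in> S \<Longrightarrow> (f has_derivative frechet_derivative f (at x)) (at x)"
  using Ck_on_Suc_differentiable frechet_derivative_works by blast

lemma Ck_on_const: "Ck_on k S (\<lambda>x. c)"
  by (induction k arbitrary: c) (auto simp: Ck_on.simps(2))

lemma Ck_on_linear: 
  assumes "open S" "bounded_linear L" 
  shows "Ck_on k S L"
proof (cases k)
  case 0
  with assms show ?thesis by (simp add: linear_continuous_on)
next
  case (Suc m)
  show ?thesis unfolding Suc
    by (rule Ck_on_SucI[where f' = "\<lambda>_. L"])
      (use assms in \<open>auto intro!: bounded_linear_imp_has_derivative Ck_on_const\<close>)
qed

lemma Ck_on_add:
  assumes "open S" "Ck_on k S f" "Ck_on k S g"
  shows "Ck_on k S (\<lambda>x. f x + g x)"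
  using assms(2,3)
proof (induction k arbitrary: f g)
  case 0
  then show ?case by (auto intro: continuous_intros)
next
  case (Suc k)
  show ?case
    by (rule Ck_on_SucI[OF \<open>open S\<close> has_derivative_add])
      (use Suc in \<open>auto intro!: Ck_on_Suc_has_derivative dest: Ck_on_frechet_derivative\<close>)
qed

lemma Ck_on_sum:
  assumes "open S" "\<And>i. i \<in> I \<Longrightarrow> Ck_on k S (f i)"
  shows "Ck_on k S (\<lambda>x. \<Sum>i\<in>I. f i x)"
  using assms(2)
  by (induction I rule: infinite_finite_induct) (auto intro: Ck_on_const Ck_on_add[OF \<open>open S\<close>])

lemma Ck_on_bilinear:
  assumes "open S" "bounded_bilinear P" "Ck_on k S f" "Ck_on k S g"
  shows "Ck_on k S (\<lambda>x. P (f x) (g x))"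
  using assms(3,4)
proof (induction k arbitrary: f g)
  case 0
  then show ?case using assms(2) by (auto intro: bounded_bilinear.continuous_on)
next
  case (Suc k)
  show ?case
  proof (rule Ck_on_SucI[OF \<open>open S\<close> bounded_bilinear.FDERIV[OF assms(2)]])
    fix x assume "x \<in> S"
    then show "(f has_derivative frechet_derivative f (at x)) (at x)"
      "(g has_derivative frechet_derivative g (at x)) (at x)"
      using Suc.prems by (auto intro: Ck_on_Suc_has_derivative)
  qed (use Suc.prems in \<open>auto intro!: Ck_on_add \<open>open S\<close> Suc.IH
        intro: Ck_on_SucD Ck_on_frechet_derivative\<close>)
qed

lemma Ck_on_bounded_linear_compose:
  assumes "open S" "bounded_linear L" "Ck_on k S f"
  shows "Ck_on k S (\<lambda>x. L (f x))"
  using assms(3)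
proof (induction k arbitrary: f)
  case 0
  then show ?case using assms(2) by (auto intro: bounded_linear.continuous_on)
next
  case (Suc k)
  show ?case
    by (rule Ck_on_SucI[OF \<open>open S\<close> bounded_linear.has_derivative[OF assms(2)]])
      (use Suc in \<open>auto intro!: Ck_on_Suc_has_derivative dest: Ck_on_frechet_derivative\<close>)
qed

text \<open>Expanding \<open>Df(x) v\<close> in a basis turns the chain rule into a finite sum of products of
  functions to which the induction hypothesis applies.\<close>

lemma Ck_on_compose:
  fixes f :: "'a::euclidean_space \<Rightarrow> 'b::euclidean_space"
  assumes "open S" "Ck_on k S f" "Ck_on k T g" "f ` S \<subseteq> T"
  shows "Ck_on k S (\<lambda>x. g (f x))"
  using assms(2,3)
proof (induction k arbitrary: g)
  case 0
  then show ?case using assms(4) by (auto intro: continuous_on_compose2)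
next
  case (Suc k)
  let ?Df = "\<lambda>x. frechet_derivative f (at x)" and ?Dg = "\<lambda>y. frechet_derivative g (at y)"
  have der: "((\<lambda>x. g (f x)) has_derivative (\<lambda>v. ?Dg (f x) (?Df x v))) (at x)" if "x \<in> S" for x
  proof -
    have "f x \<in> T" using that assms(4) by blast
    with has_derivative_compose[OF Ck_on_Suc_has_derivative[OF Suc.prems(1) that]
        Ck_on_Suc_has_derivative[OF Suc.prems(2)]]
    show ?thesis by blast
  qed
  show ?case
  proof (rule Ck_on_SucI[OF \<open>open S\<close> der])
    fix v
    have eq: "?Dg (f x) (?Df x v) = (\<Sum>b\<in>Basis. (?Df x v \<bullet> b) *\<^sub>R ?Dg (f x) b)" if "x \<in> S" for x
    proof -
      have "linear (?Dg (f x))"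
        using Suc.prems that assms(4) by (intro linear_frechet_derivative) (auto intro: Ck_on_Suc_differentiable)
      then show ?thesis
        using linear_sum[of "?Dg (f x)" "\<lambda>b. (?Df x v \<bullet> b) *\<^sub>R b" Basis]
        by (simp add: linear_cmul euclidean_representation)
    qed
    have "Ck_on k S (\<lambda>x. \<Sum>b\<in>Basis. (?Df x v \<bullet> b) *\<^sub>R ?Dg (f x) b)"
    proof (intro Ck_on_sum[OF \<open>open S\<close>] Ck_on_bilinear[OF \<open>open S\<close> bounded_bilinear_scaleR])
      fix b
      show "Ck_on k S (\<lambda>x. ?Df x v \<bullet> b)"
        by (rule Ck_on_bounded_linear_compose[OF \<open>open S\<close> bounded_linear_inner_left
              Ck_on_frechet_derivative[OF Suc.prems(1)]])
      show "Ck_on k S (\<lambda>x. ?Dg (f x) b)"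
        by (rule Suc.IH[OF Ck_on_SucD[OF Suc.prems(1)] Ck_on_frechet_derivative[OF Suc.prems(2)]])
    qed
    then show "Ck_on k S (\<lambda>x. ?Dg (f x) (?Df x v))"
      by (rule Ck_on_transform[OF \<open>open S\<close>]) (rule eq[symmetric])
  qed
qed

lemma Ck_on_real_deriv:
  fixes f f' :: "real \<Rightarrow> real"
  assumes "open S" "\<And>x. x \<in> S \<Longrightarrow> (f has_real_derivative f' x) (at x)" "Ck_on k S f'"
  shows "Ck_on (Suc k) S f"
proof (rule Ck_on_SucI[OF assms(1)])
  show "(f has_derivative (*) (f' x)) (at x)" if "x \<in> S" for x
    using assms(2)[OF that] by (simp add: has_field_derivative_def)
  show "Ck_on k S (\<lambda>x. f' x * v)" for v
    by (rule Ck_on_bounded_linear_compose[OF assms(1) bounded_linear_mult_left assms(3)])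
qed

lemma Ck_on_exp: "Ck_on k UNIV (exp :: real \<Rightarrow> real)"
proof (induction k)
  case (Suc k)
  then show ?case by (intro Ck_on_real_deriv) (auto intro: DERIV_exp)
qed (auto intro: continuous_intros)

lemma Ck_on_inverse: "Ck_on k (- {0}) (inverse :: real \<Rightarrow> real)"
proof (induction k)
  case (Suc k)
  have "Ck_on k (- {0}) (\<lambda>x::real. (-1) * (inverse x * inverse x))"
    by (intro Ck_on_bilinear[OF _ bounded_bilinear_mult] Suc Ck_on_const) auto
  then show ?case
    by (intro Ck_on_real_deriv[where f' = "\<lambda>x. (-1) * (inverse x * inverse x)"])
      (auto intro!: derivative_eq_intros)
qed (auto intro!: continuous_intros)

lemma Ck_on_sqrt: "Ck_on k {0<..} sqrt"
proof (induction k)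
  case (Suc k)
  have "Ck_on k {0<..} (\<lambda>x. inverse (sqrt x) * (1/2))"
    by (intro Ck_on_bilinear[OF _ bounded_bilinear_mult] Ck_on_const
        Ck_on_compose[OF _ Suc Ck_on_inverse]) auto
  then show ?case
    by (intro Ck_on_real_deriv[where f' = "\<lambda>x. inverse (sqrt x) * (1/2)"])
      (auto intro!: derivative_eq_intros)
qed (auto intro!: continuous_intros)

lemma smooth_on_subset: "smooth_on S f \<Longrightarrow> T \<subseteq> S \<Longrightarrow> smooth_on T f"
  by (auto simp: smooth_on_def intro: Ck_on_subset)

lemma smooth_on_imp_continuous_on: "smooth_on S f \<Longrightarrow> continuous_on S f"
  by (auto simp: smooth_on_def intro: Ck_on_imp_continuous_on)

lemma smooth_on_cong: 
  "open S \<Longrightarrow> (\<And>x. x \<in> S \<Longrightarrow> f x = g x) \<Longrightarrow> smooth_on S f \<longleftrightarrow> smooth_on S g"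
  unfolding smooth_on_def using Ck_on_cong by blast

lemma smooth_on_imp_has_derivative:
  "smooth_on S f \<Longrightarrow> x \<in> S \<Longrightarrow> (f has_derivative frechet_derivative f (at x)) (at x)"
  unfolding smooth_on_def using Ck_on_Suc_has_derivative by blast

lemma smooth_on_frechet_derivative:
  "smooth_on S f \<Longrightarrow> smooth_on S (\<lambda>x. frechet_derivative f (at x) v)"
  unfolding smooth_on_def using Ck_on_frechet_derivative by blast

named_theorems smooth_intros

lemma smooth_on_const [smooth_intros]: "smooth_on S (\<lambda>x. c)"
  by (simp add: smooth_on_def Ck_on_const)

lemma smooth_on_linear: "open S \<Longrightarrow> bounded_linear L \<Longrightarrow> smooth_on S L"
  by (simp add: smooth_on_def Ck_on_linear)

lemma smooth_on_ident [smooth_intros]: "open S \<Longrightarrow> smooth_on S (\<lambda>x. x)"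
  by (rule smooth_on_linear) auto

lemma smooth_on_add [smooth_intros]: 
  "open S \<Longrightarrow> smooth_on S f \<Longrightarrow> smooth_on S g \<Longrightarrow> smooth_on S (\<lambda>x. f x + g x)"
  by (simp add: smooth_on_def Ck_on_add)

lemma smooth_on_bilinear:
  "open S \<Longrightarrow> bounded_bilinear P \<Longrightarrow> smooth_on S f \<Longrightarrow> smooth_on S g \<Longrightarrow>
     smooth_on S (\<lambda>x. P (f x) (g x))"
  by (simp add: smooth_on_def Ck_on_bilinear)

lemmas smooth_on_scaleR [smooth_intros] = smooth_on_bilinear[OF _ bounded_bilinear_scaleR]
lemmas smooth_on_mult [smooth_intros] =
  smooth_on_bilinear[OF _ bounded_bilinear_mult]
lemmas smooth_on_inner [smooth_intros] =
  smooth_on_bilinear[OF _ bounded_bilinear_inner]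

lemma smooth_on_bounded_linear:
  "open S \<Longrightarrow> bounded_linear L \<Longrightarrow> smooth_on S f \<Longrightarrow> smooth_on S (\<lambda>x. L (f x))"
  by (simp add: smooth_on_def Ck_on_bounded_linear_compose)

lemmas smooth_on_minus [smooth_intros] =
  smooth_on_bounded_linear[OF _ bounded_linear_minus[OF bounded_linear_ident]]
lemmas smooth_on_vec_nth [smooth_intros] = smooth_on_bounded_linear[OF _ bounded_linear_vec_nth]

lemma smooth_on_diff [smooth_intros]: 
  "open S \<Longrightarrow> smooth_on S f \<Longrightarrow> smooth_on S g \<Longrightarrow> smooth_on S (\<lambda>x. f x - g x)"
  using smooth_on_add[OF _ _ smooth_on_minus, of S f g] by simp

lemma smooth_on_compose:
  fixes f :: "'a::euclidean_space \<Rightarrow> 'b::euclidean_space"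
  shows "open S \<Longrightarrow> smooth_on S f \<Longrightarrow> smooth_on T g \<Longrightarrow> f ` S \<subseteq> T \<Longrightarrow> smooth_on S (\<lambda>x. g (f x))"
  unfolding smooth_on_def using Ck_on_compose by blast

lemma smooth_on_inverse:
  "open S \<Longrightarrow> smooth_on S f \<Longrightarrow> (\<And>x. x \<in> S \<Longrightarrow> f x \<noteq> 0) \<Longrightarrow> smooth_on S (\<lambda>x. inverse (f x :: real))"
  by (rule smooth_on_compose[where T = "-{0}"]) (auto simp: smooth_on_def Ck_on_inverse)

lemma smooth_on_sqrt:
  "open S \<Longrightarrow> smooth_on S f \<Longrightarrow> (\<And>x. x \<in> S \<Longrightarrow> f x > 0) \<Longrightarrow> smooth_on S (\<lambda>x. sqrt (f x))"
  by (rule smooth_on_compose[where T = "{0<..}"]) (auto simp: smooth_on_def Ck_on_sqrt)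

lemma Ck_on_vec_lambda:
  assumes "open S" "\<And>i. Ck_on k S (\<lambda>x. f x i)"
  shows "Ck_on k S (\<lambda>x. \<chi> i. (f x i :: real))"
proof -
  have eq: "(\<chi> i. f x i) = (\<Sum>i\<in>UNIV. f x i *\<^sub>R axis i (1::real))" for x
    using basis_expansion[of "\<chi> i. f x i", symmetric] by (simp only: scalar_mult_eq_scaleR vec_lambda_beta)
  show ?thesis
    unfolding eq by (intro Ck_on_sum Ck_on_bilinear[OF _ bounded_bilinear_scaleR] assms Ck_on_const)
qed

lemma Ck_on_Pair:
  assumes "open S" "Ck_on k S f" "Ck_on k S g"
  shows "Ck_on k S (\<lambda>x. (f x, g x))"
proof -
  have "Ck_on k S (\<lambda>x. (f x, 0) + (0, g x))"
    using assms(2,3)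
    by (intro Ck_on_add assms(1) Ck_on_bounded_linear_compose[where L = "\<lambda>x. (x, 0)"]
        Ck_on_bounded_linear_compose[where L = "\<lambda>x. (0, x)"] bounded_linear_Pair bounded_linear_ident
        bounded_linear_zero)
  then show ?thesis by simp
qed

section \<open>The smooth inverse function theorem\<close>

lemma Ck_on_prod:
  fixes f :: "'i \<Rightarrow> 'a::euclidean_space \<Rightarrow> real"
  assumes "open S" "\<And>i. i \<in> I \<Longrightarrow> Ck_on k S (f i)"
  shows "Ck_on k S (\<lambda>x. \<Prod>i\<in>I. f i x)"
  using assms(2)
  by (induction I rule: infinite_finite_induct)
    (auto intro: Ck_on_const Ck_on_bilinear[OF \<open>open S\<close> bounded_bilinear_mult])

lemma Ck_on_det:
  fixes A :: "'a::euclidean_space \<Rightarrow> real^'n^'n"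
  assumes "open S" "\<And>i j. Ck_on k S (\<lambda>x. A x $ i $ j)"
  shows "Ck_on k S (\<lambda>x. det (A x))"
  unfolding det_def
  by (intro Ck_on_sum Ck_on_bilinear[OF _ bounded_bilinear_mult] Ck_on_prod Ck_on_const assms)

text \<open>By Cramer's rule the solution is a rational function of the entries of the matrix.\<close>

lemma Ck_on_linear_system_solution:
  fixes A :: "'a::euclidean_space \<Rightarrow> real^'n^'n" and w :: "'a \<Rightarrow> real^'n"
  assumes "open S" "\<And>i j. Ck_on k S (\<lambda>x. A x $ i $ j)"
    and det: "\<And>x. x \<in> S \<Longrightarrow> det (A x) \<noteq> 0" and sol: "\<And>x. x \<in> S \<Longrightarrow> A x *v w x = v"
  shows "Ck_on k S w"
proof -
  let ?B = "\<lambda>x l. \<chi> i j. if j = l then v $ i else A x $ i $ j"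
  have "Ck_on k S (\<lambda>x. ?B x l $ i $ j)" for l i j
    by (cases "j = l") (auto intro: assms Ck_on_const)
  then have "Ck_on k S (\<lambda>x. det (?B x l) * inverse (det (A x)))" for l
    by (intro Ck_on_bilinear[OF _ bounded_bilinear_mult] Ck_on_det assms(1,2)
        Ck_on_compose[OF _ _ Ck_on_inverse]) (use det in auto)
  then have "Ck_on k S (\<lambda>x. \<chi> l. det (?B x l) * inverse (det (A x)))"
    by (rule Ck_on_vec_lambda[OF \<open>open S\<close>])
  moreover have "w x = (\<chi> l. det (?B x l) * inverse (det (A x)))" if "x \<in> S" for x
    using cramer[OF det[OF that], of "w x" v] sol[OF that] by (simp add: divide_inverse)
  ultimately show ?thesis by (subst Ck_on_cong[OF \<open>open S\<close>]) auto
qed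

text \<open>The derivative of the inverse map \<open>g\<close> solves a linear system whose coefficients are derivatives of
  \<open>f\<close> at \<open>g y\<close>. Hence if \<open>g\<close> is \<open>C\<^sup>k\<close>, so is its derivative.\<close>

lemma smooth_on_inverse_map:
  fixes f g :: "real^'n \<Rightarrow> real^'n"
  assumes "open V" "smooth_on S f" "g ` V \<subseteq> S"
    and der: "\<And>y. y \<in> V \<Longrightarrow> (g has_derivative g' y) (at y)"
    and inv: "\<And>y v. y \<in> V \<Longrightarrow> frechet_derivative f (at (g y)) (g' y v) = v"
  shows "smooth_on V g"
  unfolding smooth_on_def
proof
  fix k show "Ck_on k V g"
  proof (induction k)
    case 0
    then show ?case using der
      by (auto intro!: continuous_at_imp_continuous_on has_derivative_continuous)
  next
    case (Suc k)
    let ?A = "\<lambda>y. matrix (frechet_derivative f (at (g y)))"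
    have lin: "linear (frechet_derivative f (at (g y)))" if "y \<in> V" for y
      using smooth_on_imp_has_derivative[OF assms(2)] that assms(3)
      by (blast intro: has_derivative_linear)
    have sol: "?A y *v g' y v = v" if "y \<in> V" for y v
      using inv[OF that] fun_cong[OF matrix_vector_mul(2)[OF lin[OF that]]] by simp
    have det: "det (?A y) \<noteq> 0" if "y \<in> V" for y
    proof -
      have "?A y ** matrix (g' y) = mat 1"
        using sol[OF that] fun_cong[OF matrix_vector_mul(2)[OF has_derivative_linear[OF der[OF that]]]]
        by (simp add: matrix_eq matrix_vector_mul_assoc[symmetric])
      then show ?thesis by (metis det_I det_mul mult_zero_left zero_neq_one)
    qed
    have "Ck_on k V (\<lambda>y. ?A y $ i $ j)" for i j
    proof -
      have "Ck_on k V (\<lambda>y. frechet_derivative f (at (g y)) (axis j 1) $ i)"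
        using assms(2) smooth_on_frechet_derivative[OF assms(2)]
        by (intro Ck_on_bounded_linear_compose[OF _ bounded_linear_vec_nth]
            Ck_on_compose[OF \<open>open V\<close> Suc, where T = S] assms) (auto simp: smooth_on_def)
      then show ?thesis by (simp add: matrix_def)
    qed
    then have "Ck_on k V (\<lambda>y. g' y v)" for v
      by (rule Ck_on_linear_system_solution[where A = ?A and v = v, OF \<open>open V\<close> _ det sol])
    with der show ?case by (intro Ck_on_SucI[OF \<open>open V\<close>])
  qed
qed

text \<open>The \<open>C\<^sup>1\<close> inverse function theorem yields the local inverse, which is then smooth by the previous
  lemma.\<close>

lemma smooth_inverse_function:
  fixes f :: "real^'n \<Rightarrow> real^'n"
  assumes "open S" "smooth_on S f" "p \<in> S" "inj (frechet_derivative f (at p))"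
  obtains U V g where "open U" "p \<in> U" "U \<subseteq> S" "open V" "homeomorphism U V f g" "smooth_on V g"
proof -
  let ?Df = "\<lambda>x. frechet_derivative f (at x)"
  have der: "(f has_derivative ?Df x) (at x)" if "x \<in> S" for x
    using that assms(2) by (rule smooth_on_imp_has_derivative[rotated])
  define f' where "f' x = Blinfun (?Df x)" for x
  have f': "blinfun_apply (f' x) = ?Df x" if "x \<in> S" for x
    unfolding f'_def using der[OF that] by (intro bounded_linear_Blinfun_apply has_derivative_bounded_linear)
  have cont: "continuous_on S f'"
  proof (rule continuous_on_blinfun_componentwise)
    fix i :: "real^'n" assume "i \<in> Basis"
    have "continuous_on S (\<lambda>x. ?Df x i)"
      by (intro smooth_on_imp_continuous_on smooth_on_frechet_derivative assms)
    then show "continuous_on S (\<lambda>x. blinfun_apply (f' x) i)"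
      by (simp add: f' cong: continuous_on_cong)
  qed
  obtain L where L: "linear L" "\<And>x. L (?Df p x) = x"
    using linear_injective_isomorphism[OF has_derivative_linear[OF der[OF \<open>p \<in> S\<close>]] assms(4)] by blast
  have inv: "Blinfun L o\<^sub>L f' p = id_blinfun"
    by (rule blinfun_eqI)
      (use L in \<open>simp add: f' \<open>p \<in> S\<close> bounded_linear_Blinfun_apply linear_conv_bounded_linear\<close>)
  from inverse_function_theorem[OF \<open>open S\<close> _ cont \<open>p \<in> S\<close> inv] der f'
  obtain U V g g' where *: "open U" "U \<subseteq> S" "p \<in> U" "open V" "homeomorphism U V f g"
    and g: "\<And>y. y \<in> V \<Longrightarrow> (g has_derivative (g' y)) (at y)"
      "\<And>y. y \<in> V \<Longrightarrow> g' y = inv (blinfun_apply (f' (g y)))"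
      "\<And>y. y \<in> V \<Longrightarrow> bij (blinfun_apply (f' (g y)))" by (metis (no_types, lifting))
  have gV: "g ` V \<subseteq> S"
    using \<open>homeomorphism U V f g\<close> \<open>U \<subseteq> S\<close> by (auto simp: homeomorphism_def)
  have "smooth_on V g"
  proof (rule smooth_on_inverse_map[OF \<open>open V\<close> assms(2) gV g(1)])
    fix y v assume "y \<in> V"
    then show "?Df (g y) (g' y v) = v"
      using g(2,3)[of y] f'[of "g y"] gV by (metis bij_is_surj image_subset_iff surj_f_inv_f)
  qed
  with * that show ?thesis by blast
qed

section \<open>Integrals depending on a parameter\<close>

text \<open>All parametric integrals are taken over the unit interval; variable limits are handled by
  rescaling, which avoids separate rules for the dependence on the limits.\<close>

lemma continuous_on_integral_param:
  fixes G :: "'a::euclidean_space \<times> real \<Rightarrow> real"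
  assumes "\<And>p r. p \<in> S \<Longrightarrow> r \<in> {0..1} \<Longrightarrow> (p, r) \<in> Q" "continuous_on Q G"
  shows "continuous_on S (\<lambda>p. integral {0..1} (\<lambda>r. G (p, r)))"
proof -
  have "continuous_on (Sigma S (\<lambda>_. cbox 0 1)) G"
    using assms(1) by (intro continuous_on_subset[OF assms(2)]) auto
  then have "continuous_on S (\<lambda>p. integral (cbox 0 1) (\<lambda>r. G (p, r)))"
    by (intro integral_continuous_on_param) (simp add: case_prod_unfold)
  then show ?thesis by simp
qed

lemma has_derivative_integral_param:
  fixes G :: "'a::euclidean_space \<times> real \<Rightarrow> real"
  assumes "open S" and SQ: "\<And>p r. p \<in> S \<Longrightarrow> r \<in> {0..1} \<Longrightarrow> (p, r) \<in> Q"
    and G: "Ck_on (Suc k) Q G" and "p \<in> S"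
  shows "((\<lambda>p. integral {0..1} (\<lambda>r. G (p, r))) has_derivative
          (\<lambda>v. integral {0..1} (\<lambda>r. frechet_derivative G (at (p, r)) (v, 0)))) (at p)"
proof -
  let ?D = "\<lambda>p r v. frechet_derivative G (at (p, r)) (v, 0)"
  obtain e where e: "e > 0" "ball p e \<subseteq> S"
    using \<open>open S\<close> \<open>p \<in> S\<close> by (auto simp: open_contains_ball)
  have in_Q: "(q, r) \<in> Q" if "q \<in> ball p e" "r \<in> cbox 0 1" for q r
    using that e SQ by auto
  have der: "((\<lambda>q. G (q, r)) has_derivative ?D q r) (at q)" if "q \<in> ball p e" "r \<in> cbox 0 1" for q r
  proof -
    have "((\<lambda>q. (q, r)) has_derivative (\<lambda>v. (v, 0))) (at q)"
      by (auto intro!: derivative_eq_intros)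
    from has_derivative_compose[OF this Ck_on_Suc_has_derivative[OF G in_Q[OF that]]]
    show ?thesis .
  qed
  define D where "D q r = Blinfun (?D q r)" for q r
  have D: "blinfun_apply (D q r) = ?D q r" if "q \<in> ball p e" "r \<in> cbox 0 1" for q r
    unfolding D_def using has_derivative_bounded_linear[OF der[OF that]]
    by (rule bounded_linear_Blinfun_apply)
  have contD: "continuous_on (Sigma (ball p e) (\<lambda>_. cbox 0 1)) (\<lambda>(q, r). D q r)"
  proof (rule continuous_on_blinfun_componentwise)
    fix i :: 'a
    have "continuous_on (Sigma (ball p e) (\<lambda>_. cbox 0 1)) (\<lambda>z. frechet_derivative G (at z) (i, 0))"
      by (rule continuous_on_subset[OF Ck_on_imp_continuous_on[OF Ck_on_frechet_derivative[OF G]]])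
        (use in_Q in auto)
    then show "continuous_on (Sigma (ball p e) (\<lambda>_. cbox 0 1)) (\<lambda>z. blinfun_apply (case z of (q, r) \<Rightarrow> D q r) i)"
      by (rule continuous_on_eq) (use D in auto)
  qed
  have contG: "continuous_on Q G" using G by (rule Ck_on_imp_continuous_on)
  have "((\<lambda>q. integral (cbox 0 1) (\<lambda>r. G (q, r))) has_derivative integral (cbox 0 1) (D p)) (at p within ball p e)"
  proof (rule leibniz_rule[OF _ _ contD])
    show "((\<lambda>q. G (q, r)) has_derivative blinfun_apply (D q r)) (at q within ball p e)"
      if "q \<in> ball p e" "r \<in> cbox 0 1" for q r
      using der[OF that] D[OF that] by (simp add: has_derivative_at_withinI)
    show "(\<lambda>r. G (q, r)) integrable_on cbox 0 1" if "q \<in> ball p e" for q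
      using in_Q[OF that]
      by (intro integrable_continuous continuous_on_compose2[OF contG] continuous_intros) auto
  qed (use e in auto)
  moreover have "blinfun_apply (integral (cbox 0 1) (D p)) v = integral {0..1} (\<lambda>r. ?D p r v)" for v
  proof -
    have p: "p \<in> ball p e" using e by simp
    have "continuous_on (cbox 0 1) (\<lambda>r. (p, r))" by (intro continuous_intros)
    with contD have "continuous_on (cbox 0 1) (\<lambda>r. case (p, r) of (q, r) \<Rightarrow> D q r)"
      by (rule continuous_on_compose2) (use p in auto)
    then have "continuous_on (cbox 0 1) (D p)" by simp
    then have "D p integrable_on cbox 0 1" by (rule integrable_continuous)
    then have "blinfun_apply (integral (cbox 0 1) (D p)) v = integral (cbox 0 1) (\<lambda>r. blinfun_apply (D p r) v)"
      by (rule blinfun_apply_integral)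
    also have "\<dots> = integral (cbox 0 1) (\<lambda>r. ?D p r v)"
      by (rule integral_cong) (simp add: D[OF p])
    finally show ?thesis by simp
  qed
  then have "blinfun_apply (integral (cbox 0 1) (D p)) = (\<lambda>v. integral {0..1} (\<lambda>r. ?D p r v))"
    by (rule ext)
  ultimately show ?thesis
    using e by (simp add: at_within_open[of p "ball p e"])
qed

lemma Ck_on_integral_param:
  fixes G :: "'a::euclidean_space \<times> real \<Rightarrow> real"
  assumes "open S" and SQ: "\<And>p r. p \<in> S \<Longrightarrow> r \<in> {0..1} \<Longrightarrow> (p, r) \<in> Q"
    and "Ck_on k Q G"
  shows "Ck_on k S (\<lambda>p. integral {0..1} (\<lambda>r. G (p, r)))"
  using assms(3)
proof (induction k arbitrary: G)
  case 0
  then show ?case using continuous_on_integral_param[OF SQ] by simp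
next
  case (Suc k)
  show ?case
  proof (rule Ck_on_SucI[OF \<open>open S\<close> has_derivative_integral_param[OF \<open>open S\<close> SQ Suc.prems]])
    show "Ck_on k S (\<lambda>p. integral {0..1} (\<lambda>r. frechet_derivative G (at (p, r)) (v, 0)))" for v
      by (rule Suc.IH[OF Ck_on_frechet_derivative[OF Suc.prems]])
  qed
qed

text \<open>The fundamental theorem for the integral of \<open>h\<close> from \<open>0\<close> to \<open>x\<close>, rescaled to the unit interval; it covers
  both signs of \<open>x\<close>.\<close>

lemma integral_unit_interval_rescaled:
  fixes P h :: "real \<Rightarrow> real"
  assumes "\<And>r. r \<in> {0..1} \<Longrightarrow> (P has_real_derivative h (r * x)) (at (r * x))"
  shows "x * integral {0..1} (\<lambda>r. h (r * x)) = P x - P 0"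
proof -
  have "((\<lambda>r. x * h (r * x)) has_integral (P (1 * x) - P (0 * x))) {0..1}"
  proof (rule fundamental_theorem_of_calculus)
    fix r :: real assume "r \<in> {0..1}"
    have "((\<lambda>r. r * x) has_real_derivative x) (at r)"
      by (auto intro!: derivative_eq_intros)
    from DERIV_chain2[where f = P and g = "\<lambda>r. r * x", OF assms[OF \<open>r \<in> {0..1}\<close>] this]
    show "((\<lambda>r. P (r * x)) has_vector_derivative x * h (r * x)) (at r within {0..1})"
      by (simp add: has_real_derivative_iff_has_vector_derivative[symmetric] has_field_derivative_at_within mult.commute)
  qed simp
  from integral_unique[OF this] show ?thesis by simp
qed

lemma rescaled_integral_has_derivative:
  fixes h :: "real \<Rightarrow> real"
  assumes cont: "continuous_on {-a<..<a} h" and x: "\<bar>x\<bar> < a"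
  shows "((\<lambda>x. x * integral {0..1} (\<lambda>r. h (r * x))) has_real_derivative h x) (at x)"
proof -
  obtain c where c: "\<bar>x\<bar> < c" "c < a" using x dense by blast
  have "continuous_on {-c..c} h"
    by (rule continuous_on_subset[OF cont]) (use c in auto)
  then obtain P where P: "\<And>s. s \<in> {-c..c} \<Longrightarrow> (P has_vector_derivative h s) (at s within {-c..c})"
    using antiderivative_continuous by blast
  have P': "(P has_real_derivative h s) (at s)" if "s \<in> {-c<..<c}" for s
    using P[of s] that at_within_interior[of s "{-c..c}"]
    by (simp add: has_real_derivative_iff_has_vector_derivative)
  have eq: "y * integral {0..1} (\<lambda>r. h (r * y)) = P y - P 0" if "y \<in> {-c<..<c}" for y
  proof (rule integral_unit_interval_rescaled, rule P')
    fix r :: real assume "r \<in> {0..1}"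
    then have "\<bar>r * y\<bar> \<le> \<bar>y\<bar>" by (simp add: abs_mult mult_left_le_one_le)
    then show "r * y \<in> {-c<..<c}" using that by auto
  qed
  have "((\<lambda>y. P y - P 0) has_real_derivative h x) (at x)"
    using DERIV_diff[OF P'[of x] DERIV_const[of "P 0"]] c by (simp add: abs_less_iff)
  then show ?thesis
    by (rule DERIV_cong_ev[THEN iffD1, rotated -1])
       (use eq c in \<open>auto intro!: eventually_nhds_in_open[of "{-c<..<c}", THEN eventually_mono]\<close>)
qed

section \<open>Smooth local flows of scalar differential equations\<close>

lemma abs_integral_unit_interval_le:
  fixes g :: "real \<Rightarrow> real"
  assumes "continuous_on {0..1} g" "\<And>r. \<bar>g r\<bar> \<le> B"
  shows "\<bar>integral {0..1} g\<bar> \<le> B"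
proof -
  have "norm (integral {0..1} g) \<le> integral {0..1} (\<lambda>r::real. B)"
    using assms by (intro integral_norm_bound_integral integrable_continuous_real continuous_intros) auto
  then show ?thesis by simp
qed

text \<open>Banach's fixed point theorem for the deviation \<open>\<psi>(x, y) = \<phi>(x, y) - y\<close> of the flow from the
  identity. Treating all initial values \<open>y\<close> at once, in the space of bounded continuous functions of
  \<open>(x, y)\<close>, makes the solution jointly continuous without further argument.\<close>

lemma ode_continuous_solution:
  fixes F :: "real \<times> real \<Rightarrow> real"
  assumes cont: "continuous_on UNIV F" and bound: "\<And>z. \<bar>F z\<bar> \<le> M"
    and lip: "\<And>s y y'. \<bar>F (s, y) - F (s, y')\<bar> \<le> L * \<bar>y - y'\<bar>"
    and "0 \<le> a" "a * L \<le> 1/2" "0 \<le> L"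
  obtains \<phi> :: "real \<times> real \<Rightarrow> real" where "continuous_on UNIV \<phi>"
    "\<And>x y. \<bar>\<phi> (x, y) - y\<bar> \<le> a * M"
    "\<And>x y. \<bar>x\<bar> \<le> a \<Longrightarrow> \<phi> (x, y) = y + x * integral {0..1} (\<lambda>r. F (r * x, \<phi> (r * x, y)))"
proof -
  define c where "c x = max (-a) (min a x)" for x :: real
  have c_le: "\<bar>c x\<bar> \<le> a" for x using \<open>0 \<le> a\<close> by (auto simp: c_def)
  have cont_c: "continuous_on S (\<lambda>p. c (h p))" if "continuous_on S h" for S :: "'c::topological_space set" and h
    unfolding c_def using that by (intro continuous_intros)
  define G where "G \<psi> w = F (snd w * c (fst (fst w)), snd (fst w) + \<psi> (snd w * c (fst (fst w)), snd (fst w)))"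
    for \<psi> :: "real \<times> real \<Rightarrow> real" and w :: "(real \<times> real) \<times> real"
  define T where "T \<psi> z = c (fst z) * integral {0..1} (\<lambda>r. G \<psi> (z, r))" for \<psi> z
  have cont_G: "continuous_on UNIV (G \<psi>)" if "continuous_on UNIV \<psi>" for \<psi>
    unfolding G_def
    by (intro continuous_on_compose2[OF cont] continuous_on_compose2[OF that] continuous_intros cont_c) auto
  have cont_Gr: "continuous_on {0..1} (\<lambda>r. G \<psi> (z, r))" if "continuous_on UNIV \<psi>" for \<psi> z
    by (intro continuous_on_compose2[OF cont_G[OF that]] continuous_intros) auto
  have cont_T: "continuous_on UNIV (T \<psi>)" if "continuous_on UNIV \<psi>" for \<psi>
    unfolding T_def
    by (intro continuous_intros cont_c continuous_on_integral_param[OF _ cont_G[OF that]]) auto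
  have T_le: "\<bar>T \<psi> z\<bar> \<le> a * M" if "continuous_on UNIV \<psi>" for \<psi> z
    unfolding T_def abs_mult using bound
    by (intro mult_mono c_le abs_integral_unit_interval_le cont_Gr that) (auto simp: G_def \<open>0 \<le> a\<close>)
  have T_bcontfun: "T \<psi> \<in> bcontfun" if "continuous_on UNIV \<psi>" for \<psi>
    using cont_T[OF that] T_le[OF that] by (intro bcontfun_normI[where b = "a * M"]) auto
  define T' where "T' \<psi> = Bcontfun (T (apply_bcontfun \<psi>))" for \<psi>
  have T': "apply_bcontfun (T' \<psi>) = T (apply_bcontfun \<psi>)" for \<psi>
    unfolding T'_def by (rule Bcontfun_inverse) (simp add: T_bcontfun)
  have "dist (T' \<psi>\<^sub>1) (T' \<psi>\<^sub>2) \<le> 1/2 * dist \<psi>\<^sub>1 \<psi>\<^sub>2" for \<psi>\<^sub>1 \<psi>\<^sub>2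
  proof (rule dist_bound)
    fix z
    let ?G = "\<lambda>\<psi> r. G (apply_bcontfun \<psi>) (z, r)"
    have cont_G': "continuous_on {0..1} (?G \<psi>)" for \<psi>
      by (rule cont_Gr) simp
    have int: "?G \<psi> integrable_on {0..1}" for \<psi>
      by (rule integrable_continuous_real[OF cont_G'])
    have "\<bar>?G \<psi>\<^sub>1 r - ?G \<psi>\<^sub>2 r\<bar> \<le> L * dist \<psi>\<^sub>1 \<psi>\<^sub>2" for r
    proof -
      let ?p = "(r * c (fst z), snd z)"
      have "\<bar>?G \<psi>\<^sub>1 r - ?G \<psi>\<^sub>2 r\<bar> \<le> L * \<bar>apply_bcontfun \<psi>\<^sub>1 ?p - apply_bcontfun \<psi>\<^sub>2 ?p\<bar>"
        unfolding G_def by (rule order_trans[OF lip]) simp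
      also have "\<dots> \<le> L * dist \<psi>\<^sub>1 \<psi>\<^sub>2"
        using dist_bounded[of \<psi>\<^sub>1 ?p \<psi>\<^sub>2] \<open>0 \<le> L\<close> by (intro mult_left_mono) (auto simp: dist_real_def)
      finally show ?thesis .
    qed
    then have "\<bar>integral {0..1} (\<lambda>r. ?G \<psi>\<^sub>1 r - ?G \<psi>\<^sub>2 r)\<bar> \<le> L * dist \<psi>\<^sub>1 \<psi>\<^sub>2"
      by (intro abs_integral_unit_interval_le continuous_intros cont_G')
    then have "\<bar>c (fst z)\<bar> * \<bar>integral {0..1} (?G \<psi>\<^sub>1) - integral {0..1} (?G \<psi>\<^sub>2)\<bar> \<le> a * (L * dist \<psi>\<^sub>1 \<psi>\<^sub>2)"
      using c_le \<open>0 \<le> a\<close> by (intro mult_mono) (auto simp: integral_diff[OF int int])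
    also have "\<dots> \<le> 1/2 * dist \<psi>\<^sub>1 \<psi>\<^sub>2"
      using mult_right_mono[OF \<open>a * L \<le> 1/2\<close> zero_le_dist[of \<psi>\<^sub>1 \<psi>\<^sub>2]] by (simp add: mult.assoc)
    finally show "dist (apply_bcontfun (T' \<psi>\<^sub>1) z) (apply_bcontfun (T' \<psi>\<^sub>2) z) \<le> 1/2 * dist \<psi>\<^sub>1 \<psi>\<^sub>2"
      by (simp add: T' T_def dist_real_def abs_mult[symmetric] right_diff_distrib)
  qed
  then obtain \<psi> where "T' \<psi> = \<psi>"
    using banach_fix_type[of "1/2" T'] by auto
  then have fixp: "apply_bcontfun \<psi> z = T (apply_bcontfun \<psi>) z" for z
    using T'[of \<psi>] by simp
  show thesis
  proof (rule that[of "\<lambda>z. snd z + apply_bcontfun \<psi> z"])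
    show "continuous_on UNIV (\<lambda>z. snd z + apply_bcontfun \<psi> z)"
      by (intro continuous_intros continuous_on_apply_bcontfun)
    show "\<bar>snd (x, y) + apply_bcontfun \<psi> (x, y) - y\<bar> \<le> a * M" for x y
      using T_le[of "apply_bcontfun \<psi>" "(x, y)"] fixp[of "(x, y)"] by simp
    show "snd (x, y) + apply_bcontfun \<psi> (x, y) = y + x * integral {0..1} (\<lambda>r. F (r * x, snd (r * x, y) + apply_bcontfun \<psi> (r * x, y)))"
      if "\<bar>x\<bar> \<le> a" for x y
    proof -
      have "c x = x" using that by (auto simp: c_def)
      then show ?thesis using fixp[of "(x, y)"] by (simp add: T_def G_def)
    qed
  qed
qed

lemma has_real_derivative_partial_snd:
  fixes f :: "real \<times> real \<Rightarrow> real"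
  assumes "Ck_on (Suc k) W f" "(s, y) \<in> W"
  shows "((\<lambda>y. f (s, y)) has_real_derivative frechet_derivative f (at (s, y)) (0, 1)) (at y)"
proof -
  have "((\<lambda>y. (s, y)) has_derivative (\<lambda>v. (0, v))) (at y)"
    by (auto intro!: derivative_eq_intros)
  from has_derivative_compose[OF this Ck_on_Suc_has_derivative[OF assms]]
  have "((\<lambda>y. f (s, y)) has_derivative (\<lambda>v. frechet_derivative f (at (s, y)) (0, v))) (at y)" .
  moreover have "(\<lambda>v. frechet_derivative f (at (s, y)) (0, v)) = (*) (frechet_derivative f (at (s, y)) (0, 1))"
  proof
    fix v
    show "frechet_derivative f (at (s, y)) (0, v) = frechet_derivative f (at (s, y)) (0, 1) * v"
      using linear_cmul[OF linear_frechet_derivative[OF Ck_on_Suc_differentiable[OF assms]], of v "(0, 1)"]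
      by (simp add: mult.commute)
  qed
  ultimately show ?thesis unfolding has_field_derivative_def by (simp only:)
qed

text \<open>A locally defined right-hand side is replaced by its composition with the projection onto a square, which is bounded
  and globally Lipschitz in \<open>y\<close>. For small \<open>\<rho>\<close> the solutions stay in the square, where nothing has
  been changed.\<close>

lemma continuous_local_flow:
  fixes f :: "real \<times> real \<Rightarrow> real"
  assumes "open W" "(0, 0) \<in> W" and f: "Ck_on (Suc 0) W f"
  obtains \<rho> R \<phi> where "0 < \<rho>" "\<rho> \<le> R" "\<And>s y. \<bar>s\<bar> \<le> R \<Longrightarrow> \<bar>y\<bar> \<le> R \<Longrightarrow> (s, y) \<in> W"
    "continuous_on UNIV \<phi>"
    "\<And>x y. \<bar>x\<bar> < \<rho> \<Longrightarrow> \<bar>y\<bar> < \<rho> \<Longrightarrow> \<bar>\<phi> (x, y)\<bar> < R"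
    "\<And>x y. \<bar>x\<bar> < \<rho> \<Longrightarrow> \<bar>y\<bar> < \<rho> \<Longrightarrow>
       \<phi> (x, y) = y + x * integral {0..1} (\<lambda>r. f (r * x, \<phi> (r * x, y)))"
proof -
  obtain e where e: "e > 0" "ball (0, 0) e \<subseteq> W"
    using assms(1,2) by (auto simp: open_contains_ball)
  define R where "R = e / 3"
  have R: "0 < R" using e by (simp add: R_def)
  have RW: "(s, y) \<in> W" if "\<bar>s\<bar> \<le> R" "\<bar>y\<bar> \<le> R" for s y
  proof -
    have "norm (s, y) \<le> \<bar>s\<bar> + \<bar>y\<bar>" using norm_Pair_le[of s y] by simp
    also have "\<dots> < e" using that R by (simp add: R_def)
    finally show ?thesis using e by (auto simp: dist_norm norm_Pair)
  qed
  let ?K = "cbox (-R, -R) (R, R)"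
  have KW: "?K \<subseteq> W" using RW by (auto simp: cbox_Pair_eq abs_le_iff)
  let ?fy = "\<lambda>z. frechet_derivative f (at z) (0, 1)"
  have cont_f: "continuous_on ?K f" and cont_fy: "continuous_on ?K ?fy"
    by (rule continuous_on_subset[OF Ck_on_imp_continuous_on[OF f] KW],
        rule continuous_on_subset[OF Ck_on_imp_continuous_on[OF Ck_on_frechet_derivative[OF f]] KW])
  obtain M where M: "0 < M" "\<And>z. z \<in> ?K \<Longrightarrow> \<bar>f z\<bar> \<le> M"
    using compact_imp_bounded[OF compact_continuous_image[OF cont_f compact_cbox]]
    unfolding bounded_pos ball_simps real_norm_def by blast
  obtain L where L: "0 < L" "\<And>z. z \<in> ?K \<Longrightarrow> \<bar>?fy z\<bar> \<le> L"
    using compact_imp_bounded[OF compact_continuous_image[OF cont_fy compact_cbox]]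
    unfolding bounded_pos ball_simps real_norm_def by blast
  note der = has_real_derivative_partial_snd[OF f]
  define c where "c t = max (-R) (min R t)" for t
  have c: "\<bar>c t\<bar> \<le> R" "c t \<in> {-R..R}" "\<bar>t\<bar> \<le> R \<Longrightarrow> c t = t" "\<bar>c t - c t'\<bar> \<le> \<bar>t - t'\<bar>" for t t'
    using R by (auto simp: c_def)
  have cK: "(c s, c y) \<in> ?K" for s y using c(2) by (auto simp: cbox_Pair_eq)
  define F where "F z = f (c (fst z), c (snd z))" for z
  \<comment> \<open>the second bound keeps the solutions in the square, the third makes the fixed point operator a contraction\<close>
  define \<rho> where "\<rho> = min R (min (R / (2 * (1 + M))) (1 / (2 * L)))"
  have \<rho>: "0 < \<rho>" "\<rho> \<le> R" using R M(1) L(1) by (auto simp: \<rho>_def)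
  have \<rho>M: "\<rho> * (1 + M) \<le> R / 2"
  proof -
    have "\<rho> \<le> R / (2 * (1 + M))" by (simp add: \<rho>_def)
    then show ?thesis using M(1) by (simp add: field_simps)
  qed
  have \<rho>L: "\<rho> * L \<le> 1/2"
  proof -
    have "\<rho> \<le> 1 / (2 * L)" by (simp add: \<rho>_def)
    then show ?thesis using L(1) by (simp add: field_simps)
  qed
  have cont_F: "continuous_on UNIV F"
    unfolding F_def c_def using cK
    by (intro continuous_on_compose2[OF cont_f] continuous_intros) (auto simp: c_def[symmetric])
  have F_le: "\<bar>F z\<bar> \<le> M" for z
    unfolding F_def by (rule M(2)[OF cK])
  have F_lip: "\<bar>F (s, y) - F (s, y')\<bar> \<le> L * \<bar>y - y'\<bar>" for s y y'
  proof -
    have "norm (f (c s, c y) - f (c s, c y')) \<le> L * norm (c y - c y')"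
    proof (rule field_differentiable_bound[of "{-R..R}"])
      fix t assume t: "t \<in> {-R..R}"
      then have "(c s, t) \<in> ?K" using c(2)[of s] by (auto simp: cbox_Pair_eq)
      then show "norm (?fy (c s, t)) \<le> L" using L(2) by simp
      show "((\<lambda>y. f (c s, y)) has_real_derivative ?fy (c s, t)) (at t within {-R..R})"
        using der[of "c s" t] \<open>(c s, t) \<in> ?K\<close> KW by (blast intro: has_field_derivative_at_within)
    qed (use c(2) in auto)
    also have "\<dots> \<le> L * \<bar>y - y'\<bar>" using c(4) L(1) by (intro mult_left_mono) auto
    finally show ?thesis by (simp add: F_def)
  qed
  have nonneg: "0 \<le> \<rho>" "0 \<le> L" using \<rho>(1) L(1) by auto
  obtain \<phi> where \<phi>: "continuous_on UNIV \<phi>" "\<And>x y. \<bar>\<phi> (x, y) - y\<bar> \<le> \<rho> * M"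
    "\<And>x y. \<bar>x\<bar> \<le> \<rho> \<Longrightarrow> \<phi> (x, y) = y + x * integral {0..1} (\<lambda>r. F (r * x, \<phi> (r * x, y)))"
    using ode_continuous_solution[OF cont_F F_le F_lip nonneg(1) \<rho>L nonneg(2)] by blast
  have small: "\<bar>\<phi> (x, y)\<bar> < R" if "\<bar>y\<bar> < \<rho>" for x y
    using \<phi>(2)[of x y] that \<rho>M R by (auto simp: algebra_simps abs_le_iff abs_less_iff)
  show thesis
  proof (rule that[OF \<rho> RW \<phi>(1) small])
    fix x y assume xy: "\<bar>x\<bar> < \<rho>" "\<bar>y\<bar> < \<rho>"
    have "F (r * x, \<phi> (r * x, y)) = f (r * x, \<phi> (r * x, y))" if "r \<in> {0..1}" for r
    proof -
      have "\<bar>r * x\<bar> \<le> \<bar>x\<bar>" using that by (simp add: abs_mult mult_left_le_one_le)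
      then have "c (r * x) = r * x" using xy \<rho> by (intro c(3)) auto
      moreover have "c (\<phi> (r * x, y)) = \<phi> (r * x, y)"
        using small[OF xy(2), of "r * x"] by (intro c(3)) auto
      ultimately show ?thesis by (simp add: F_def)
    qed
    then have "integral {0..1} (\<lambda>r. F (r * x, \<phi> (r * x, y))) = integral {0..1} (\<lambda>r. f (r * x, \<phi> (r * x, y)))"
      by (intro integral_cong)
    then show "\<phi> (x, y) = y + x * integral {0..1} (\<lambda>r. f (r * x, \<phi> (r * x, y)))"
      using \<phi>(3)[of x y] xy by simp
  qed auto
qed

text \<open>The setting in which the regularity of the flow is studied: a continuous solution of the integral
  equation whose values stay in a square contained in the domain of \<open>f\<close>.\<close>

locale local_flow =
  fixes f \<phi> :: "real \<times> real \<Rightarrow> real" and W :: "(real \<times> real) set" and \<rho> R :: real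
  assumes f: "smooth_on W f"
    and KW: "\<And>s y. \<bar>s\<bar> \<le> R \<Longrightarrow> \<bar>y\<bar> \<le> R \<Longrightarrow> (s, y) \<in> W"
    and \<rho>: "0 < \<rho>" "\<rho> \<le> R"
    and cont_\<phi>: "continuous_on UNIV \<phi>"
    and \<phi>_less: "\<And>x y. \<bar>x\<bar> < \<rho> \<Longrightarrow> \<bar>y\<bar> < \<rho> \<Longrightarrow> \<bar>\<phi> (x, y)\<bar> < R"
    and flow: "\<And>x y. \<bar>x\<bar> < \<rho> \<Longrightarrow> \<bar>y\<bar> < \<rho> \<Longrightarrow>
       \<phi> (x, y) = y + x * integral {0..1} (\<lambda>r. f (r * x, \<phi> (r * x, y)))"
begin

definition f_y where "f_y z = frechet_derivative f (at z) (0, 1)"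

text \<open>The quotient \<open>(f(x, b) - f(x, a)) / (b - a)\<close> at \<open>a = \<phi>(x, y\<^sub>0)\<close> and \<open>b = \<phi>(x, y\<^sub>1)\<close>, in Hadamard's integral
  form, which stays continuous where the two solutions meet.\<close>

definition hadamard_quotient where
  "hadamard_quotient x y\<^sub>0 y\<^sub>1 = integral {0..1} (\<lambda>r. f_y (x, \<phi> (x, y\<^sub>0) + r * (\<phi> (x, y\<^sub>1) - \<phi> (x, y\<^sub>0))))"

definition growth where
  "growth x y\<^sub>0 y\<^sub>1 = x * integral {0..1} (\<lambda>r. hadamard_quotient (r * x) y\<^sub>0 y\<^sub>1)"

definition \<phi>_y where "\<phi>_y z = exp (growth (fst z) (snd z) (snd z))"

abbreviation "square \<equiv> {z :: real \<times> real. \<bar>fst z\<bar> < \<rho> \<and> \<bar>snd z\<bar> < \<rho>}"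

abbreviation "cube \<equiv> {w :: real \<times> real \<times> real. \<bar>fst w\<bar> < \<rho> \<and> \<bar>fst (snd w)\<bar> < \<rho> \<and> \<bar>snd (snd w)\<bar> < \<rho>}"

lemma Ck_f: "Ck_on k W f"
  using f by (simp add: smooth_on_def)

lemma smooth_f_y: "smooth_on W f_y"
  unfolding f_y_def using f by (rule smooth_on_frechet_derivative)

lemma open_square: "open square"
  unfolding Collect_conj_eq by (intro open_Int open_Collect_less continuous_intros)

lemma scaled_less: "r \<in> {0..1} \<Longrightarrow> \<bar>x\<bar> < \<rho> \<Longrightarrow> \<bar>r * x\<bar> < \<rho>" for r x :: real
  by (rule le_less_trans[of _ "\<bar>x\<bar>"]) (simp_all add: abs_mult mult_left_le_one_le)

lemma graph_in: "\<bar>x\<bar> < \<rho> \<Longrightarrow> \<bar>y\<bar> < \<rho> \<Longrightarrow> (x, \<phi> (x, y)) \<in> W"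
  using \<phi>_less[of x y] \<rho> by (intro KW) auto

lemma segment_in:
  assumes "\<bar>x\<bar> < \<rho>" "\<bar>y\<^sub>0\<bar> < \<rho>" "\<bar>y\<^sub>1\<bar> < \<rho>" "r \<in> {0..1}"
  shows "(x, \<phi> (x, y\<^sub>0) + r * (\<phi> (x, y\<^sub>1) - \<phi> (x, y\<^sub>0))) \<in> W"
proof (rule KW)
  show "\<bar>x\<bar> \<le> R" using assms \<rho> by simp
  have "(1 - r) *\<^sub>R \<phi> (x, y\<^sub>0) + r *\<^sub>R \<phi> (x, y\<^sub>1) \<in> {-R..R}"
    using \<phi>_less[of x y\<^sub>0] \<phi>_less[of x y\<^sub>1] assms
    by (intro convexD[OF convex_real_interval(5)]) auto
  then show "\<bar>\<phi> (x, y\<^sub>0) + r * (\<phi> (x, y\<^sub>1) - \<phi> (x, y\<^sub>0))\<bar> \<le> R"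
    by (simp add: abs_le_iff algebra_simps)
qed

lemma continuous_hadamard_quotient:
  "continuous_on cube (\<lambda>w. hadamard_quotient (fst w) (fst (snd w)) (snd (snd w)))"
proof -
  let ?G = "\<lambda>v. f_y (fst (fst v), \<phi> (fst (fst v), fst (snd (fst v))) +
              snd v * (\<phi> (fst (fst v), snd (snd (fst v))) - \<phi> (fst (fst v), fst (snd (fst v)))))"
  have "continuous_on {v. fst v \<in> cube \<and> snd v \<in> {0..1}} ?G"
    by (intro continuous_on_compose2[OF smooth_on_imp_continuous_on[OF smooth_f_y]]
        continuous_on_compose2[OF cont_\<phi>] continuous_intros subset_UNIV) (auto intro!: segment_in)
  from continuous_on_integral_param[OF _ this, of cube] show ?thesis
    unfolding hadamard_quotient_def by simp
qed

lemma continuous_growth: "continuous_on cube (\<lambda>w. growth (fst w) (fst (snd w)) (snd (snd w)))"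
proof -
  let ?G = "\<lambda>v. hadamard_quotient (snd v * fst (fst v)) (fst (snd (fst v))) (snd (snd (fst v)))"
  have "continuous_on {v. fst v \<in> cube \<and> snd v \<in> {0..1}}
      (\<lambda>v. (\<lambda>w. hadamard_quotient (fst w) (fst (snd w)) (snd (snd w))) (snd v * fst (fst v), snd (fst v)))"
    by (intro continuous_on_compose2[OF continuous_hadamard_quotient] continuous_intros)
      (auto intro!: scaled_less)
  then have "continuous_on {v. fst v \<in> cube \<and> snd v \<in> {0..1}} ?G" by simp
  from continuous_on_integral_param[OF _ this, of cube] show ?thesis
    unfolding growth_def by (auto intro!: continuous_intros)
qed

lemma \<phi>_y_eq: "\<phi>_y z = exp (fst z * integral {0..1} (\<lambda>r. f_y (r * fst z, \<phi> (r * fst z, snd z))))"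
  by (simp add: \<phi>_y_def growth_def hadamard_quotient_def)

lemma \<phi>_has_derivative_fst:
  assumes "\<bar>x\<bar> < \<rho>" "\<bar>y\<bar> < \<rho>"
  shows "((\<lambda>x. \<phi> (x, y)) has_real_derivative f (x, \<phi> (x, y))) (at x)"
proof -
  have "continuous_on {-\<rho><..<\<rho>} (\<lambda>s. f (s, \<phi> (s, y)))"
    using assms
    by (intro continuous_on_compose2[OF smooth_on_imp_continuous_on[OF f]]
        continuous_on_compose2[OF cont_\<phi>] continuous_intros subset_UNIV) (auto intro!: graph_in)
  from DERIV_add[OF DERIV_const[of y] rescaled_integral_has_derivative[OF this assms(1)]]
  have "((\<lambda>x. y + x * integral {0..1} (\<lambda>r. f (r * x, \<phi> (r * x, y)))) has_real_derivative f (x, \<phi> (x, y))) (at x)"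
    by simp
  then show ?thesis
  proof (rule has_field_derivative_transform_within_open[of _ _ _ "{-\<rho><..<\<rho>}"])
    show "x \<in> {-\<rho><..<\<rho>}" using assms(1) by (simp add: abs_less_iff)
    show "y + s * integral {0..1} (\<lambda>r. f (r * s, \<phi> (r * s, y))) = \<phi> (s, y)" if "s \<in> {-\<rho><..<\<rho>}" for s
      using flow[of s y] that assms by (simp add: abs_less_iff)
  qed simp
qed

text \<open>The difference of two solutions satisfies a linear differential equation whose coefficient is the
  Hadamard quotient, and is therefore given by an exponential. This one formula yields the
  derivative with respect to the initial value, as the limit \<open>y\<^sub>1 \<rightarrow> y\<^sub>0\<close>.\<close>

lemma flow_difference:
  assumes "\<bar>x\<bar> < \<rho>" "\<bar>y\<^sub>0\<bar> < \<rho>" "\<bar>y\<^sub>1\<bar> < \<rho>"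
  shows "\<phi> (x, y\<^sub>1) - \<phi> (x, y\<^sub>0) = (y\<^sub>1 - y\<^sub>0) * exp (growth x y\<^sub>0 y\<^sub>1)"
proof -
  let ?d = "\<lambda>x. \<phi> (x, y\<^sub>1) - \<phi> (x, y\<^sub>0)" and ?q = "\<lambda>x. hadamard_quotient x y\<^sub>0 y\<^sub>1"
  have d: "(?d has_real_derivative ?d s * ?q s) (at s)" if "\<bar>s\<bar> < \<rho>" for s
  proof -
    have "?d s * ?q s = f (s, \<phi> (s, y\<^sub>0) + ?d s) - f (s, \<phi> (s, y\<^sub>0) + 0)"
      unfolding hadamard_quotient_def
    proof (rule integral_unit_interval_rescaled)
      fix r :: real assume "r \<in> {0..1}"
      then have "(s, \<phi> (s, y\<^sub>0) + r * ?d s) \<in> W" using that assms by (intro segment_in)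
      note f_deriv = has_real_derivative_partial_snd[OF Ck_f this]
      have "((\<lambda>t. \<phi> (s, y\<^sub>0) + t) has_real_derivative 1) (at (r * ?d s))"
        by (auto intro!: derivative_eq_intros)
      from DERIV_chain2[where g = "\<lambda>t. \<phi> (s, y\<^sub>0) + t", OF f_deriv this]
      show "((\<lambda>t. f (s, \<phi> (s, y\<^sub>0) + t)) has_real_derivative f_y (s, \<phi> (s, y\<^sub>0) + r * ?d s)) (at (r * ?d s))"
        by (simp add: f_y_def)
    qed
    then show ?thesis
      using DERIV_diff[OF \<phi>_has_derivative_fst[OF that assms(3)] \<phi>_has_derivative_fst[OF that assms(2)]] by simp
  qed
  have cont_q: "continuous_on {-\<rho><..<\<rho>} ?q"
  proof -
    have "continuous_on {-\<rho><..<\<rho>} (\<lambda>s. (\<lambda>w. hadamard_quotient (fst w) (fst (snd w)) (snd (snd w))) (s, y\<^sub>0, y\<^sub>1))"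
      by (intro continuous_on_compose2[OF continuous_hadamard_quotient] continuous_intros)
        (use assms in auto)
    then show ?thesis by simp
  qed
  have E: "((\<lambda>x. growth x y\<^sub>0 y\<^sub>1) has_real_derivative ?q s) (at s)" if "\<bar>s\<bar> < \<rho>" for s
    unfolding growth_def by (rule rescaled_integral_has_derivative[OF cont_q that])
  \<comment> \<open>integrating factor of the linear equation for \<open>?d\<close>\<close>
  let ?h = "\<lambda>s. ?d s * exp (- growth s y\<^sub>0 y\<^sub>1)"
  have "?h x = ?h 0"
  proof (rule DERIV_isconst3[where f = ?h and a = "-\<rho>" and b = \<rho>])
    fix s assume "s \<in> {-\<rho><..<\<rho>}"
    then have "\<bar>s\<bar> < \<rho>" by (simp add: abs_less_iff)
    from DERIV_mult[OF d[OF this] DERIV_fun_exp[OF DERIV_minus[OF E[OF this]]]]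
    show "(?h has_real_derivative 0) (at s)" by (simp add: algebra_simps)
  qed (use assms \<rho> in \<open>auto simp: abs_less_iff\<close>)
  also have "?h 0 = y\<^sub>1 - y\<^sub>0"
    using flow[of 0 y\<^sub>0] flow[of 0 y\<^sub>1] assms \<rho> by (simp add: growth_def)
  finally show ?thesis by (simp add: exp_minus field_simps)
qed

lemma continuous_\<phi>_y: "continuous_on square \<phi>_y"
proof -
  have "continuous_on square (\<lambda>z. (\<lambda>w. growth (fst w) (fst (snd w)) (snd (snd w))) (fst z, snd z, snd z))"
    by (intro continuous_on_compose2[OF continuous_growth] continuous_intros) auto
  then show ?thesis unfolding \<phi>_y_def by (auto intro!: continuous_intros)
qed

lemma \<phi>_has_derivative_snd:
  assumes "\<bar>x\<bar> < \<rho>" "\<bar>y\<bar> < \<rho>"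
  shows "((\<lambda>y. \<phi> (x, y)) has_real_derivative \<phi>_y (x, y)) (at y)"
  unfolding has_field_derivative_iff
proof (rule Lim_transform_within_open)
  have "continuous_on {-\<rho><..<\<rho>} (\<lambda>t. (\<lambda>w. growth (fst w) (fst (snd w)) (snd (snd w))) (x, y, t))"
    by (intro continuous_on_compose2[OF continuous_growth] continuous_intros) (use assms in auto)
  then have "isCont (\<lambda>t. growth x y t) y"
    using assms by (simp add: continuous_on_eq_continuous_at abs_less_iff)
  then show "((\<lambda>t. exp (growth x y t)) \<longlongrightarrow> \<phi>_y (x, y)) (at y)"
    unfolding \<phi>_y_def by (auto intro!: tendsto_intros simp: isCont_def)
  show "y \<in> {-\<rho><..<\<rho>}" using assms by (simp add: abs_less_iff)
  show "exp (growth x y t) = (\<phi> (x, t) - \<phi> (x, y)) / (t - y)" if "t \<in> {-\<rho><..<\<rho>}" "t \<noteq> y" for t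
    using flow_difference[OF assms, of t] that by (simp add: abs_less_iff)
qed simp

text \<open>Both partial derivatives exist and the second one is continuous, which gives total differentiability.\<close>

lemma \<phi>_has_derivative:
  assumes "z \<in> square"
  shows "(\<phi> has_derivative (\<lambda>v. fst v * f (fst z, \<phi> z) + snd v * \<phi>_y z)) (at z)"
proof -
  obtain x y where z: "z = (x, y)" by fastforce
  let ?I = "{-\<rho><..<\<rho>}"
  have xy: "x \<in> ?I" "y \<in> ?I" using assms by (auto simp: z abs_less_iff)
  have sq: "Sigma ?I (\<lambda>_. ?I) = square" by (auto simp: abs_less_iff)
  have scaleR_left: "blinfun_apply (blinfun_scaleR_left c) = (*) c" for c :: real
    by (simp add: fun_eq_iff mult.commute)
  have "((\<lambda>(x, y). \<phi> (x, y)) has_derivative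
      (\<lambda>(tx, ty). f (x, \<phi> (x, y)) * tx + blinfun_scaleR_left (\<phi>_y (x, y)) ty))
      (at (x, y) within Sigma ?I (\<lambda>_. ?I))"
  proof (rule has_derivative_partialsI)
    show "((\<lambda>x. \<phi> (x, y)) has_derivative (*) (f (x, \<phi> (x, y)))) (at x within ?I)"
      using \<phi>_has_derivative_fst[of x y] xy
      by (auto simp: abs_less_iff has_field_derivative_def intro: has_derivative_at_withinI)
    show "((\<lambda>t. \<phi> (s, t)) has_derivative blinfun_scaleR_left (\<phi>_y (s, t))) (at t within ?I)"
      if "s \<in> ?I" "t \<in> ?I" for s t
      using \<phi>_has_derivative_snd[of s t] that unfolding scaleR_left
      by (auto simp: abs_less_iff has_field_derivative_def intro: has_derivative_at_withinI)
    have "continuous_on square (\<lambda>z. blinfun_scaleR_left (\<phi>_y z))"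
      by (intro continuous_intros continuous_\<phi>_y)
    then show "continuous (at (x, y) within Sigma ?I (\<lambda>_. ?I)) (\<lambda>(x, y). blinfun_scaleR_left (\<phi>_y (x, y)))"
      using assms by (simp add: sq z continuous_on_eq_continuous_within case_prod_beta')
  qed (use xy in auto)
  then show ?thesis
    using at_within_open[OF assms open_square]
    by (simp add: sq z case_prod_beta' scaleR_left mult.commute)
qed

text \<open>Both partial derivatives, \<open>f(x, \<phi>)\<close> and the exponential of the integral of \<open>f_y(x, \<phi>)\<close>, are expressions in
  \<open>\<phi>\<close> itself. So if \<open>\<phi>\<close> is \<open>C\<^sup>k\<close>, its derivative is \<open>C\<^sup>k\<close> as well, on the same square.\<close>

lemma smooth_\<phi>: "smooth_on square \<phi>"
  unfolding smooth_on_def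
proof
  fix k show "Ck_on k square \<phi>"
  proof (induction k)
    case 0
    show ?case using cont_\<phi> by (auto intro: continuous_on_subset)
  next
    case (Suc k)
    note [simp] = open_square
    have "Ck_on k square (\<lambda>z. (fst z, \<phi> z))"
      by (rule Ck_on_Pair) (auto intro: Ck_on_linear bounded_linear_fst Suc)
    then have f: "Ck_on k square (\<lambda>z. f (fst z, \<phi> z))"
      by (rule Ck_on_compose[OF open_square _ Ck_f]) (auto intro: graph_in)
    define Q where "Q = {w :: (real \<times> real) \<times> real. \<bar>snd w * fst (fst w)\<bar> < \<rho> \<and> \<bar>snd (fst w)\<bar> < \<rho>}"
    have "open Q" unfolding Q_def Collect_conj_eq
      by (intro open_Int open_Collect_less continuous_intros)
    let ?s = "\<lambda>w. snd w * fst (fst w)"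
    have s: "Ck_on k Q ?s"
      by (intro Ck_on_bilinear[OF _ bounded_bilinear_mult] Ck_on_linear \<open>open Q\<close> bounded_linear_intros)
    have "Ck_on k Q (\<lambda>w. \<phi> (?s w, snd (fst w)))"
      by (rule Ck_on_compose[OF \<open>open Q\<close> Ck_on_Pair[OF \<open>open Q\<close> s] Suc])
        (auto intro!: Ck_on_linear bounded_linear_intros simp: Q_def \<open>open Q\<close>[unfolded Q_def])
    then have "Ck_on k Q (\<lambda>w. f_y (?s w, \<phi> (?s w, snd (fst w))))"
      by (intro Ck_on_compose[OF \<open>open Q\<close> Ck_on_Pair[OF \<open>open Q\<close> s], where T = W and g = f_y])
         (use smooth_f_y in \<open>auto simp: smooth_on_def Q_def intro: graph_in\<close>)
    then have "Ck_on k square (\<lambda>z. integral {0..1} (\<lambda>r. (\<lambda>w. f_y (?s w, \<phi> (?s w, snd (fst w)))) (z, r)))"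
      by (rule Ck_on_integral_param[OF open_square, rotated]) (auto simp: Q_def intro: scaled_less)
    then have "Ck_on k square (\<lambda>z. fst z * integral {0..1} (\<lambda>r. f_y (r * fst z, \<phi> (r * fst z, snd z))))"
      by (intro Ck_on_bilinear[OF _ bounded_bilinear_mult]) (auto intro: Ck_on_linear bounded_linear_fst)
    then have "Ck_on k square \<phi>_y"
      unfolding \<phi>_y_eq[abs_def] by (rule Ck_on_compose[OF open_square _ Ck_on_exp]) simp
    with f show ?case
      by (intro Ck_on_SucI[OF open_square \<phi>_has_derivative] Ck_on_add
          Ck_on_bilinear[OF _ bounded_bilinear_mult] Ck_on_const open_square)
  qed
qed

lemma \<phi>_initial: "\<bar>y\<bar> < \<rho> \<Longrightarrow> \<phi> (0, y) = y"
  using flow[of 0 y] \<rho> by simp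

end

lemma smooth_local_flow:
  fixes f :: "real \<times> real \<Rightarrow> real"
  assumes "open W" "(0, 0) \<in> W" "smooth_on W f"
  obtains \<rho> and \<phi> m :: "real \<times> real \<Rightarrow> real"
  where "0 < \<rho>" "smooth_on {z. \<bar>fst z\<bar> < \<rho> \<and> \<bar>snd z\<bar> < \<rho>} \<phi>" "\<phi> (0, 0) = 0" 
    "\<And>x y. \<bar>x\<bar> < \<rho> \<Longrightarrow> \<bar>y\<bar> < \<rho> \<Longrightarrow> (x, \<phi> (x, y)) \<in> W \<and> m (x, y) > 0 \<and>
       (\<phi> has_derivative (\<lambda>v. fst v * f (x, \<phi> (x, y)) + snd v * m (x, y))) (at (x, y))"
proof -
  have "Ck_on (Suc 0) W f" using assms(3) unfolding smooth_on_def by blast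
  from continuous_local_flow[OF assms(1,2) this] obtain \<rho> R \<phi> where
    "0 < \<rho>" "\<rho> \<le> R" "\<And>s y. \<bar>s\<bar> \<le> R \<Longrightarrow> \<bar>y\<bar> \<le> R \<Longrightarrow> (s, y) \<in> W"
    "continuous_on UNIV \<phi>"
    "\<And>x y. \<bar>x\<bar> < \<rho> \<Longrightarrow> \<bar>y\<bar> < \<rho> \<Longrightarrow> \<bar>\<phi> (x, y)\<bar> < R"
    "\<And>x y. \<bar>x\<bar> < \<rho> \<Longrightarrow> \<bar>y\<bar> < \<rho> \<Longrightarrow>
       \<phi> (x, y) = y + x * integral {0..1} (\<lambda>r. f (r * x, \<phi> (r * x, y)))"
    by blast
  with assms(3) interpret local_flow f \<phi> W \<rho> R by (intro local_flow.intro)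
  show thesis
    using \<rho>(1) smooth_\<phi> \<phi>_initial[of 0] graph_in \<phi>_has_derivative
    by (intro that[of \<rho> \<phi> \<phi>_y]) (auto simp: \<phi>_y_def)
qed

section \<open>First integrals of planar covector fields\<close>

text \<open>The kernel of \<open>\<alpha>\<close> is spanned by \<open>e\<^sub>1 + f e\<^sub>2\<close>, where \<open>f\<close> is a slope function in the basis \<open>e\<^sub>1, e\<^sub>2\<close>. Its
  integral curves, parametrised by their initial values, give a local diffeomorphism \<open>\<Phi>\<close>; the
  initial value, as a function of the point, is constant on these curves and has non-zero derivative
  across them.\<close>

lemma first_integral_of_covector_field:
  fixes \<alpha> :: "real^2 \<Rightarrow> real^2"
  assumes "open U" "smooth_on U \<alpha>" "p \<in> U" "\<alpha> p \<noteq> 0"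
  obtains V and h :: "real^2 \<Rightarrow> real" where "open V" "p \<in> V" "V \<subseteq> U" "smooth_on V h"
    "\<And>q w. q \<in> V \<Longrightarrow> frechet_derivative h (at q) w = 0 \<Longrightarrow> \<alpha> q \<bullet> w = 0"
proof -
  \<comment> \<open>an orthogonal basis in which the kernel at \<open>p\<close> is spanned by \<open>e\<^sub>1\<close>, so that near \<open>p\<close> it is a graph over \<open>e\<^sub>1\<close>\<close>
  define e\<^sub>2 where "e\<^sub>2 = \<alpha> p"
  define e\<^sub>1 where "e\<^sub>1 = (vector [- (\<alpha> p $ 2), \<alpha> p $ 1] :: real^2)"
  have "e\<^sub>2 \<bullet> e\<^sub>2 > 0" using \<open>\<alpha> p \<noteq> 0\<close> by (simp add: e\<^sub>2_def)
  moreover have "e\<^sub>1 \<bullet> e\<^sub>2 = 0" "e\<^sub>1 \<bullet> e\<^sub>1 = e\<^sub>2 \<bullet> e\<^sub>2"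
    by (simp_all add: e\<^sub>1_def e\<^sub>2_def inner_vec_def sum_2)
  ultimately have orth: "e\<^sub>1 \<bullet> e\<^sub>2 = 0" "e\<^sub>1 \<bullet> e\<^sub>1 = e\<^sub>2 \<bullet> e\<^sub>2" "e\<^sub>2 \<bullet> e\<^sub>2 > 0" by auto
  define L where "L z = p + fst z *\<^sub>R e\<^sub>1 + snd z *\<^sub>R e\<^sub>2" for z :: "real \<times> real"
  have L_smooth: "smooth_on S L" if "open S" for S
    unfolding L_def
    by (intro smooth_intros smooth_on_linear bounded_linear_fst bounded_linear_snd that)
  have L_cont: "continuous_on UNIV L"
    using L_smooth smooth_on_imp_continuous_on by blast
  define W where "W = {z \<in> L -` U. \<alpha> (L z) \<bullet> e\<^sub>2 \<noteq> 0}"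
  have "open (L -` U)" using L_cont \<open>open U\<close> by (simp add: open_vimage)
  moreover have "continuous_on (L -` U) (\<lambda>z. \<alpha> (L z) \<bullet> e\<^sub>2)"
    by (intro continuous_intros continuous_on_compose2[OF smooth_on_imp_continuous_on[OF assms(2)]]
        continuous_on_subset[OF L_cont]) auto
  ultimately have "open (L -` U \<inter> (\<lambda>z. \<alpha> (L z) \<bullet> e\<^sub>2) -` (- {0}))"
    by (intro continuous_open_preimage) auto
  also have "\<dots> = W" unfolding W_def by blast
  finally have "open W" .
  have W: "(0, 0) \<in> W"
    using assms orth by (simp add: W_def L_def e\<^sub>2_def)
  have \<alpha>L: "smooth_on W (\<lambda>z. \<alpha> (L z))"
    by (rule smooth_on_compose[OF \<open>open W\<close> L_smooth[OF \<open>open W\<close>] assms(2)]) (auto simp: W_def)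
  define f where "f z = - (\<alpha> (L z) \<bullet> e\<^sub>1) * inverse (\<alpha> (L z) \<bullet> e\<^sub>2)" for z
  have "smooth_on W f"
    unfolding f_def
    by (intro smooth_intros smooth_on_inverse \<alpha>L \<open>open W\<close>) (auto simp: W_def)
  obtain \<rho> \<phi> m where \<rho>: "0 < \<rho>" and \<phi>: "smooth_on {z. \<bar>fst z\<bar> < \<rho> \<and> \<bar>snd z\<bar> < \<rho>} \<phi>" "\<phi> (0, 0) = (0::real)"
    and flow: "\<And>x y. \<bar>x\<bar> < \<rho> \<Longrightarrow> \<bar>y\<bar> < \<rho> \<Longrightarrow> (x, \<phi> (x, y)) \<in> W \<and> m (x, y) > 0 \<and>
       (\<phi> has_derivative (\<lambda>v. fst v * f (x, \<phi> (x, y)) + snd v * m (x, y))) (at (x, y))"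
    by (rule smooth_local_flow[OF \<open>open W\<close> W \<open>smooth_on W f\<close>]) blast
  define S where "S = {q :: real^2. \<bar>q $ 1\<bar> < \<rho> \<and> \<bar>q $ 2\<bar> < \<rho>}"
  have "open S" unfolding S_def Collect_conj_eq
    by (intro open_Int open_Collect_less continuous_intros)
  have "0 \<in> S" using \<rho> by (simp add: S_def)
  define \<Phi> where "\<Phi> q = L (q $ 1, \<phi> (q $ 1, q $ 2))" for q :: "real^2"
  have lin: "bounded_linear (\<lambda>q::real^2. (q $ 1, q $ 2))"
    by (intro bounded_linear_Pair bounded_linear_vec_nth)
  have \<Phi>_der: "(\<Phi> has_derivative (\<lambda>\<zeta>. \<zeta> $ 1 *\<^sub>R e\<^sub>1 +
      (\<zeta> $ 1 * f (q $ 1, \<phi> (q $ 1, q $ 2)) + \<zeta> $ 2 * m (q $ 1, q $ 2)) *\<^sub>R e\<^sub>2)) (at q)"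
    if "q \<in> S" for q
  proof -
    have "((\<lambda>q. \<phi> (q $ 1, q $ 2)) has_derivative
        (\<lambda>\<zeta>. \<zeta> $ 1 * f (q $ 1, \<phi> (q $ 1, q $ 2)) + \<zeta> $ 2 * m (q $ 1, q $ 2))) (at q)"
      using has_derivative_compose[OF bounded_linear_imp_has_derivative[OF lin], of \<phi> _ q]
        flow[of "q $ 1" "q $ 2"] that by (fastforce simp: S_def)
    moreover have "((\<lambda>q. q $ 1) has_derivative (\<lambda>\<zeta>. \<zeta> $ 1)) (at q)"
      by (intro bounded_linear_imp_has_derivative bounded_linear_vec_nth)
    ultimately show ?thesis
      using has_derivative_add[OF has_derivative_add[OF has_derivative_const[of p] has_derivative_scaleR_left]
          has_derivative_scaleR_left] by (fastforce simp: \<Phi>_def[abs_def] L_def)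
  qed
  have "smooth_on S \<Phi>"
  proof -
    have "smooth_on S (\<lambda>q. \<phi> (q $ 1, q $ 2))"
      by (rule smooth_on_compose[OF \<open>open S\<close> smooth_on_linear[OF \<open>open S\<close> lin] \<phi>(1)]) (auto simp: S_def)
    then show ?thesis
      unfolding \<Phi>_def L_def fst_conv snd_conv
      by (intro smooth_intros \<open>open S\<close>)
  qed
  have D\<Phi>: "frechet_derivative \<Phi> (at q) = (\<lambda>\<zeta>. \<zeta> $ 1 *\<^sub>R e\<^sub>1 +
      (\<zeta> $ 1 * f (q $ 1, \<phi> (q $ 1, q $ 2)) + \<zeta> $ 2 * m (q $ 1, q $ 2)) *\<^sub>R e\<^sub>2)" if "q \<in> S" for q
    by (rule frechet_derivative_at[OF \<Phi>_der[OF that], symmetric])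
  have "inj (frechet_derivative \<Phi> (at 0))"
  proof (subst linear_injective_0)
    show "linear (frechet_derivative \<Phi> (at 0))"
      unfolding D\<Phi>[OF \<open>0 \<in> S\<close>] using has_derivative_linear[OF \<Phi>_der[OF \<open>0 \<in> S\<close>]] .
    have "\<zeta> = 0" if eq: "frechet_derivative \<Phi> (at 0) \<zeta> = 0" for \<zeta>
    proof -
      let ?c = "\<zeta> $ 1 * f (0, \<phi> (0, 0)) + \<zeta> $ 2 * m (0, 0)"
      have *: "\<zeta> $ 1 *\<^sub>R e\<^sub>1 + ?c *\<^sub>R e\<^sub>2 = 0" using eq by (simp add: D\<Phi>[OF \<open>0 \<in> S\<close>])
      from arg_cong[OF *, of "\<lambda>w. w \<bullet> e\<^sub>1"] have 1: "\<zeta> $ 1 = 0"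
        using orth by (simp add: inner_add_left inner_commute[of e\<^sub>2 e\<^sub>1])
      from arg_cong[OF *, of "\<lambda>w. w \<bullet> e\<^sub>2"] have "?c = 0"
        using orth by (simp add: inner_add_left)
      then have "\<zeta> $ 2 = 0" using 1 flow[of 0 0] \<rho> by simp
      with 1 show ?thesis by (simp add: vec_eq_iff forall_2)
    qed
    then show "\<forall>\<zeta>. frechet_derivative \<Phi> (at 0) \<zeta> = 0 \<longrightarrow> \<zeta> = 0" by blast
  qed
  from smooth_inverse_function[OF \<open>open S\<close> \<open>smooth_on S \<Phi>\<close> \<open>0 \<in> S\<close> this]
  obtain S' V g where S': "open S'" "0 \<in> S'" "S' \<subseteq> S" and "open V"
    and hom: "homeomorphism S' V \<Phi> g" and g: "smooth_on V g" .
  have gV: "g q \<in> S" "\<Phi> (g q) = q" if "q \<in> V" for q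
    using hom that \<open>S' \<subseteq> S\<close> by (auto simp: homeomorphism_def)
  have "\<Phi> 0 = p" using \<phi>(2) by (simp add: \<Phi>_def L_def)
  then have "p \<in> V" using hom \<open>0 \<in> S'\<close> by (auto simp: homeomorphism_def)
  show thesis
  proof (rule that[of V "\<lambda>q. g q $ 2"])
    show "V \<subseteq> U"
    proof
      fix q assume "q \<in> V"
      then have "L (g q $ 1, \<phi> (g q $ 1, g q $ 2)) \<in> U"
        using flow[of "g q $ 1" "g q $ 2"] gV(1)[of q] by (simp add: S_def W_def)
      then show "q \<in> U" using gV(2)[OF \<open>q \<in> V\<close>] by (simp add: \<Phi>_def)
    qed
    show "smooth_on V (\<lambda>q. g q $ 2)" by (intro smooth_intros g \<open>open V\<close>)
    fix q w assume "q \<in> V" and w: "frechet_derivative (\<lambda>q. g q $ 2) (at q) w = 0"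
    define \<zeta> where "\<zeta> = frechet_derivative g (at q) w"
    note dg = smooth_on_imp_has_derivative[OF g \<open>q \<in> V\<close>]
    have "\<zeta> $ 2 = 0"
      using w frechet_derivative_at[OF bounded_linear.has_derivative[OF bounded_linear_vec_nth dg, of 2]]
      by (simp add: \<zeta>_def fun_eq_iff)
    have "((\<lambda>q. \<Phi> (g q)) has_derivative (\<lambda>w. frechet_derivative \<Phi> (at (g q)) (frechet_derivative g (at q) w))) (at q)"
      by (rule has_derivative_compose[OF dg smooth_on_imp_has_derivative[OF \<open>smooth_on S \<Phi>\<close> gV(1)[OF \<open>q \<in> V\<close>]]])
    moreover have "((\<lambda>q. \<Phi> (g q)) has_derivative (\<lambda>w. w)) (at q)"
      by (rule has_derivative_transform_within_open[OF has_derivative_ident \<open>open V\<close> \<open>q \<in> V\<close>]) (simp add: gV)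
    ultimately have "frechet_derivative \<Phi> (at (g q)) \<zeta> = w"
      unfolding \<zeta>_def by (metis has_derivative_unique)
    then have w_eq: "w = \<zeta> $ 1 *\<^sub>R (e\<^sub>1 + f (g q $ 1, \<phi> (g q $ 1, g q $ 2)) *\<^sub>R e\<^sub>2)"
      using \<open>\<zeta> $ 2 = 0\<close> by (simp add: D\<Phi>[OF gV(1)[OF \<open>q \<in> V\<close>]] scaleR_add_right)
    have "L (g q $ 1, \<phi> (g q $ 1, g q $ 2)) = q" using gV(2)[OF \<open>q \<in> V\<close>] by (simp add: \<Phi>_def)
    moreover have "(g q $ 1, \<phi> (g q $ 1, g q $ 2)) \<in> W"
      using flow[of "g q $ 1" "g q $ 2"] gV(1)[OF \<open>q \<in> V\<close>] by (simp add: S_def)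
    ultimately show "\<alpha> q \<bullet> w = 0"
      by (simp add: w_eq inner_add_right inner_diff_right f_def W_def)
  qed (use \<open>open V\<close> \<open>p \<in> V\<close> in auto)
qed

section \<open>Symmetry of second derivatives\<close>

text \<open>The second difference over the parallelogram spanned by \<open>h u\<close> and \<open>h v\<close> is, by two applications of the mean
  value theorem, an iterated derivative at some point of the parallelogram.\<close>

lemma second_difference_mean_value:
  fixes f :: "'a::euclidean_space \<Rightarrow> real"
  assumes f: "Ck_on (Suc (Suc k)) S f" and "ball p e \<subseteq> S"
    and "0 < h" "h * (norm u + norm v) < e"
  obtains q where "norm (q - p) \<le> h * (norm u + norm v)"
    "f (p + h *\<^sub>R u + h *\<^sub>R v) - f (p + h *\<^sub>R u) - (f (p + h *\<^sub>R v) - f p) =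
       h\<^sup>2 * frechet_derivative (\<lambda>x. frechet_derivative f (at x) u) (at q) v"
proof -
  let ?D = "\<lambda>x. frechet_derivative f (at x) u"
  have norm_le: "norm (s *\<^sub>R u + t *\<^sub>R v) \<le> h * (norm u + norm v)"
    if "s \<in> {0..h}" "t \<in> {0..h}" for s t
  proof -
    have "norm (s *\<^sub>R u + t *\<^sub>R v) \<le> s * norm u + t * norm v"
      using that by (intro order_trans[OF norm_triangle_ineq]) simp
    also have "\<dots> \<le> h * norm u + h * norm v"
      using that by (intro add_mono mult_right_mono) auto
    finally show ?thesis by (simp add: distrib_left)
  qed
  have in_S: "p + s *\<^sub>R u + t *\<^sub>R v \<in> S" if "s \<in> {0..h}" "t \<in> {0..h}" for s t
  proof -
    have "norm (s *\<^sub>R u + t *\<^sub>R v) < e" using norm_le[OF that] assms(4) by simp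
    then have "dist (p + (s *\<^sub>R u + t *\<^sub>R v)) p < e" by (simp add: dist_norm)
    then have "p + s *\<^sub>R u + t *\<^sub>R v \<in> ball p e"
      unfolding mem_ball by (metis dist_commute add.assoc)
    then show ?thesis using assms(2) by blast
  qed
  have line: "((\<lambda>s. g (a + s *\<^sub>R b)) has_real_derivative frechet_derivative g (at (a + s *\<^sub>R b)) b) (at s)"
    if "Ck_on (Suc j) S g" "a + s *\<^sub>R b \<in> S" for g :: "'a \<Rightarrow> real" and a b s j
  proof -
    have "((\<lambda>s. a + s *\<^sub>R b) has_derivative (\<lambda>t. t *\<^sub>R b)) (at s)"
      by (auto intro!: derivative_eq_intros)
    from has_derivative_compose[OF this Ck_on_Suc_has_derivative[OF that]]
    have "((\<lambda>s. g (a + s *\<^sub>R b)) has_derivative (\<lambda>t. frechet_derivative g (at (a + s *\<^sub>R b)) (t *\<^sub>R b))) (at s)" .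
    moreover have "(\<lambda>t. frechet_derivative g (at (a + s *\<^sub>R b)) (t *\<^sub>R b)) = (*) (frechet_derivative g (at (a + s *\<^sub>R b)) b)"
      using linear_cmul[OF linear_frechet_derivative[OF Ck_on_Suc_differentiable[OF that]]]
      by (simp add: fun_eq_iff mult.commute)
    ultimately show ?thesis unfolding has_field_derivative_def by (simp only:)
  qed
  have "\<exists>\<xi>>0. \<xi> < h \<and>
      (f (p + h *\<^sub>R v + h *\<^sub>R u) - f (p + h *\<^sub>R u)) - (f (p + h *\<^sub>R v + 0 *\<^sub>R u) - f (p + 0 *\<^sub>R u)) =
      (h - 0) * (?D (p + h *\<^sub>R v + \<xi> *\<^sub>R u) - ?D (p + \<xi> *\<^sub>R u))"
  proof (rule MVT2[OF \<open>0 < h\<close>])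
    fix s assume "0 \<le> s" "s \<le> h"
    then have "p + h *\<^sub>R v + s *\<^sub>R u \<in> S" "p + s *\<^sub>R u \<in> S"
      using in_S[of s h] in_S[of s 0] \<open>0 < h\<close> by (simp_all add: add_ac)
    from DERIV_diff[OF line[OF f this(1)] line[OF f this(2)]]
    show "((\<lambda>s. f (p + h *\<^sub>R v + s *\<^sub>R u) - f (p + s *\<^sub>R u)) has_real_derivative
        ?D (p + h *\<^sub>R v + s *\<^sub>R u) - ?D (p + s *\<^sub>R u)) (at s)" .
  qed
  then obtain \<xi> where \<xi>: "0 < \<xi>" "\<xi> < h"
    and eq1: "f (p + h *\<^sub>R u + h *\<^sub>R v) - f (p + h *\<^sub>R u) - (f (p + h *\<^sub>R v) - f p) =
      h * (?D (p + \<xi> *\<^sub>R u + h *\<^sub>R v) - ?D (p + \<xi> *\<^sub>R u))"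
    by (auto simp: add_ac)
  have "\<exists>\<eta>>0. \<eta> < h \<and> ?D (p + \<xi> *\<^sub>R u + h *\<^sub>R v) - ?D (p + \<xi> *\<^sub>R u + 0 *\<^sub>R v) =
      (h - 0) * frechet_derivative ?D (at (p + \<xi> *\<^sub>R u + \<eta> *\<^sub>R v)) v"
  proof (rule MVT2[OF \<open>0 < h\<close>])
    fix t assume "0 \<le> t" "t \<le> h"
    then have "p + \<xi> *\<^sub>R u + t *\<^sub>R v \<in> S" using in_S[of \<xi> t] \<xi> by simp
    from line[OF Ck_on_frechet_derivative[OF f] this]
    show "((\<lambda>t. ?D (p + \<xi> *\<^sub>R u + t *\<^sub>R v)) has_real_derivative
        frechet_derivative ?D (at (p + \<xi> *\<^sub>R u + t *\<^sub>R v)) v) (at t)" .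
  qed
  then obtain \<eta> where \<eta>: "0 < \<eta>" "\<eta> < h"
    and eq2: "?D (p + \<xi> *\<^sub>R u + h *\<^sub>R v) - ?D (p + \<xi> *\<^sub>R u) =
      h * frechet_derivative ?D (at (p + \<xi> *\<^sub>R u + \<eta> *\<^sub>R v)) v"
    by auto
  show thesis
  proof (rule that)
    show "norm ((p + \<xi> *\<^sub>R u + \<eta> *\<^sub>R v) - p) \<le> h * (norm u + norm v)"
      using norm_le[of \<xi> \<eta>] \<xi> \<eta> by (simp add: algebra_simps)
    show "f (p + h *\<^sub>R u + h *\<^sub>R v) - f (p + h *\<^sub>R u) - (f (p + h *\<^sub>R v) - f p) =
       h\<^sup>2 * frechet_derivative ?D (at (p + \<xi> *\<^sub>R u + \<eta> *\<^sub>R v)) v"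
      by (simp only: eq1 eq2 power2_eq_square mult.assoc)
  qed
qed

text \<open>The second difference does not depend on the order of \<open>u\<close> and \<open>v\<close>. So the two iterated derivatives agree at
  points arbitrarily close to \<open>p\<close>, and they are continuous.\<close>

lemma second_derivative_symmetric:
  fixes f :: "'a::euclidean_space \<Rightarrow> real"
  assumes "open S" and f: "Ck_on (Suc (Suc 0)) S f" and "p \<in> S"
  shows "frechet_derivative (\<lambda>x. frechet_derivative f (at x) u) (at p) v =
         frechet_derivative (\<lambda>x. frechet_derivative f (at x) v) (at p) u"
proof (rule ccontr)
  let ?A = "\<lambda>u v q. frechet_derivative (\<lambda>x. frechet_derivative f (at x) u) (at q) v"
  assume ne: "?A u v p \<noteq> ?A v u p"
  define \<epsilon> where "\<epsilon> = dist (?A u v p) (?A v u p) / 2"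
  have "\<epsilon> > 0" using ne by (simp add: \<epsilon>_def)
  obtain e where e: "e > 0" "ball p e \<subseteq> S"
    using \<open>open S\<close> \<open>p \<in> S\<close> by (auto simp: open_contains_ball)
  have "continuous_on S (?A u v)" for u v
    using Ck_on_frechet_derivative[OF Ck_on_frechet_derivative[OF f]] by simp
  then have "isCont (?A u v) p" for u v
    using \<open>open S\<close> \<open>p \<in> S\<close> by (simp add: continuous_on_eq_continuous_at)
  then have "\<exists>d>0. \<forall>q. dist q p < d \<longrightarrow> dist (?A u v q) (?A u v p) < \<epsilon>" for u v
    using \<open>\<epsilon> > 0\<close> unfolding continuous_at_eps_delta by blast
  then obtain d\<^sub>1 d\<^sub>2 where d: "d\<^sub>1 > 0" "d\<^sub>2 > 0"
    "\<And>q. dist q p < d\<^sub>1 \<Longrightarrow> dist (?A u v q) (?A u v p) < \<epsilon>"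
    "\<And>q. dist q p < d\<^sub>2 \<Longrightarrow> dist (?A v u q) (?A v u p) < \<epsilon>"
    by meson
  define m where "m = min e (min d\<^sub>1 d\<^sub>2)"
  define h where "h = m / (2 * (norm u + norm v + 1))"
  have "m > 0" using d e by (simp add: m_def)
  have "norm u + norm v + 1 > 0" by (simp add: add_nonneg_pos)
  then have "0 < h" using \<open>m > 0\<close> by (simp add: h_def)
  have "h * (norm u + norm v) < m"
  proof -
    have "h * (norm u + norm v) \<le> h * (norm u + norm v + 1)"
      using \<open>0 < h\<close> by (intro mult_left_mono) auto
    also have "\<dots> = m / 2"
      using \<open>norm u + norm v + 1 > 0\<close> unfolding h_def by (simp add: divide_simps)
    finally show ?thesis using \<open>m > 0\<close> by simp
  qed
  then have small: "h * (norm u + norm v) < e" "h * (norm u + norm v) < d\<^sub>1" "h * (norm v + norm u) < e" "h * (norm v + norm u) < d\<^sub>2"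
    by (auto simp: m_def add.commute)
  obtain q where q: "norm (q - p) \<le> h * (norm u + norm v)"
    "f (p + h *\<^sub>R u + h *\<^sub>R v) - f (p + h *\<^sub>R u) - (f (p + h *\<^sub>R v) - f p) = h\<^sup>2 * ?A u v q"
    by (rule second_difference_mean_value[OF f e(2) \<open>0 < h\<close> small(1)])
  obtain q' where q': "norm (q' - p) \<le> h * (norm v + norm u)"
    "f (p + h *\<^sub>R v + h *\<^sub>R u) - f (p + h *\<^sub>R v) - (f (p + h *\<^sub>R u) - f p) = h\<^sup>2 * ?A v u q'"
    by (rule second_difference_mean_value[OF f e(2) \<open>0 < h\<close> small(3)])
  have "h\<^sup>2 * ?A u v q = h\<^sup>2 * ?A v u q'"
    unfolding q(2)[symmetric] q'(2)[symmetric] by (simp add: add_ac)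
  then have "?A u v q = ?A v u q'" using \<open>0 < h\<close> by simp
  moreover have "dist (?A u v q) (?A u v p) < \<epsilon>" "dist (?A v u q') (?A v u p) < \<epsilon>"
    using d(3)[of q] d(4)[of q'] q(1) q'(1) small by (auto simp: dist_norm)
  ultimately show False
    using dist_triangle3[of "?A u v p" "?A v u p" "?A u v q"] by (simp add: \<epsilon>_def)
qed

section \<open>Vector algebra of asymptotic directions\<close>

lemma cross3_of_orthogonal_to_unit:
  fixes n u v :: "real^3"
  assumes "norm n = 1" "n \<bullet> u = 0" "n \<bullet> v = 0"
  shows "cross3 u v = (n \<bullet> cross3 u v) *\<^sub>R n"
proof -
  have "cross3 n (cross3 u v) = 0" using assms by (simp add: Lagrange)
  then have "cross3 n (cross3 n (cross3 u v)) = 0" by simp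
  then show ?thesis
    using assms(1) unfolding Lagrange[of n n] by (simp add: norm_eq_1)
qed

text \<open>The determinant of \<open>Dn - \<delta> (n \<times> Dx)\<close> on the plane orthogonal to \<open>n\<close>, where \<open>a, b\<close> stand for the partial
  derivatives of \<open>x\<close> and \<open>c, d\<close> for those of \<open>n\<close>. Its expansion is \<open>det (c, d) + \<delta>\<^sup>2 det (a, b)\<close>, up
  to the mixed term \<open>\<delta> (a \<bullet> d - b \<bullet> c)\<close>; the hypotheses make both parts vanish.\<close>

lemma rotated_difference_dependent:
  fixes n a b c d :: "real^3"
  assumes n: "norm n = 1" "n \<bullet> a = 0" "n \<bullet> b = 0" "n \<bullet> c = 0" "n \<bullet> d = 0"
    and sym: "a \<bullet> d = b \<bullet> c" and curv: "cross3 c d = - \<delta>\<^sup>2 *\<^sub>R cross3 a b"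
  shows "cross3 (c - \<delta> *\<^sub>R cross3 n a) (d - \<delta> *\<^sub>R cross3 n b) = 0"
proof -
  have 1: "n \<bullet> cross3 c (cross3 n b) = c \<bullet> b"
    using n by (simp add: Lagrange inner_diff_right norm_eq_1)
  have 2: "n \<bullet> cross3 (cross3 n a) d = - (d \<bullet> a)"
    using n unfolding cross_skew[of "cross3 n a" d] by (simp add: Lagrange inner_diff_right norm_eq_1)
  have 3: "n \<bullet> cross3 (cross3 n a) (cross3 n b) = n \<bullet> cross3 a b"
    using n cross_triple[of n a b] unfolding Lagrange
    by (simp add: inner_diff_right norm_eq_1 dot_cross_self inner_commute)
  have "n \<bullet> cross3 (c - \<delta> *\<^sub>R cross3 n a) (d - \<delta> *\<^sub>R cross3 n b) =
      n \<bullet> cross3 c d - \<delta> * (n \<bullet> cross3 c (cross3 n b)) - \<delta> * (n \<bullet> cross3 (cross3 n a) d)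
      + \<delta>\<^sup>2 * (n \<bullet> cross3 (cross3 n a) (cross3 n b))"
    by (simp add: Cross3.left_diff_distrib Cross3.right_diff_distrib cross_mult_left cross_mult_right
        inner_diff_right inner_diff_left power2_eq_square algebra_simps)
  also have "\<dots> = 0"
    unfolding 1 2 3 curv using sym by (simp add: inner_commute algebra_simps)
  finally show ?thesis
    using cross3_of_orthogonal_to_unit[OF n(1), of "c - \<delta> *\<^sub>R cross3 n a" "d - \<delta> *\<^sub>R cross3 n b"] n
    by (simp add: inner_diff_right dot_cross_self)
qed

lemma derivative_of_locally_constant:
  assumes "(f has_derivative f') (at q)" "open V" "q \<in> V" "\<And>q. q \<in> V \<Longrightarrow> f q = c"
  shows "f' w = 0"
proof -
  have "(f has_derivative (\<lambda>w. 0)) (at q)"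
    by (rule has_derivative_transform_within_open[OF has_derivative_const[of c] assms(2,3)]) (simp add: assms(4))
  from fun_cong[OF has_derivative_unique[OF assms(1) this]] show ?thesis .
qed

lemma linear_real2_expand:
  fixes A :: "real^2 \<Rightarrow> 'b::real_vector"
  assumes "linear A"
  shows "A w = w $ 1 *\<^sub>R A (axis 1 1) + w $ 2 *\<^sub>R A (axis 2 1)"
proof -
  have "w = w $ 1 *\<^sub>R axis 1 1 + w $ 2 *\<^sub>R axis 2 1"
    by (simp add: vec_eq_iff forall_2 axis_def)
  from arg_cong[OF this, of A] show ?thesis
    by (simp only: linear_add[OF assms] linear_cmul[OF assms])
qed

text \<open>For a map of rank at most one, a single component that does not vanish identically determines the
  whole kernel. This reduces the vector equation of an asymptotic direction to a scalar one.\<close>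

lemma kernel_of_rank_one:
  fixes A :: "real^2 \<Rightarrow> real^3"
  assumes "linear A" "cross3 (A (axis 1 1)) (A (axis 2 1)) = 0"
    and "A w' \<bullet> a \<noteq> 0" "A w \<bullet> a = 0"
  shows "A w = 0"
proof -
  have "cross3 (A w) (A w') = (w $ 1 * w' $ 2 - w $ 2 * w' $ 1) *\<^sub>R cross3 (A (axis 1 1)) (A (axis 2 1))"
    unfolding linear_real2_expand[OF assms(1), of w] linear_real2_expand[OF assms(1), of w']
    using cross_skew[of "A (axis 2 1)" "A (axis 1 1)"]
    by (simp add: cross_add_left cross_add_right cross_mult_left cross_mult_right algebra_simps)
  then have "cross3 a (cross3 (A w) (A w')) = 0" using assms(2) by simp
  then show ?thesis
    using assms(3,4) by (simp add: Lagrange inner_commute)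
qed

lemma column_jacobian: "column i (jacobian f (at q)) = frechet_derivative f (at q) (axis i 1)"
  by (simp add: column_def jacobian_def matrix_def vec_eq_iff)

lemma det_transpose_mul_columns:
  fixes A B :: "real^2^3"
  shows "det (transpose A ** B) =
    cross3 (column 1 A) (column 2 A) \<bullet> cross3 (column 1 B) (column 2 B)"
proof -
  have "(transpose A ** B) $ i $ j = column i A \<bullet> column j B" for i j
    by (simp add: matrix_matrix_mult_def transpose_def column_def inner_vec_def)
  then show ?thesis unfolding det_2 dot_cross by simp
qed

lemma bounded_bilinear_cross3: "bounded_bilinear cross3"
  using bilinear_cross by (simp add: bilinear_conv_bounded_bilinear)

lemma cross3_columns_nonzero:
  fixes a b :: "real^3"
  assumes "a \<noteq> b" "independent {a, b}"
  shows "cross3 a b \<noteq> 0"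
proof
  assume "cross3 a b = 0"
  then have "collinear {0, a, b}" by (simp add: cross_eq_0)
  then consider "a = 0" | "b = 0" | c where "b = c *\<^sub>R a"
    unfolding collinear_lemma by blast
  then show False
  proof cases
    case 3
    then have "b \<in> span ({a, b} - {b})" using assms(1) by (simp add: span_base span_scale)
    then show ?thesis using assms(2) unfolding dependent_def by blast
  qed (use assms(2) dependent_zero[of "{a, b}"] in auto)
qed

section \<open>Asymptotic directions of a wavefront of negative curvature\<close>

locale negative_wavefront =
  fixes U :: "(real^2) set"
    and x :: "real^2 \<Rightarrow> real^3"
    and \<Omega> :: "real^2 \<Rightarrow> real^2^3"
    and \<kappa> :: "real^2 \<Rightarrow> real"
  assumes open_U: "open U"
    and wf: "wavefront U x"
    and proper: "proper_frontal U x"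
    and tmb: "tangent_moving_basis U x \<Omega>"
    and ext: "gaussian_curvature_extension U x \<Omega> \<kappa>"
    and neg: "\<forall>q\<in>U. \<kappa> q < 0"
begin

abbreviation "n \<equiv> induced_normal \<Omega>"
abbreviation "Dx q \<equiv> frechet_derivative x (at q)"
abbreviation "Dn q \<equiv> frechet_derivative n (at q)"

lemma smooth_x: "smooth_on U x"
  using wf by (simp add: wavefront_def frontal_def)

lemma smooth_n: "smooth_on U n"
proof -
  define w where "w q = cross3 (column 1 (\<Omega> q)) (column 2 (\<Omega> q))" for q
  have col: "bounded_linear (column i :: real^2^3 \<Rightarrow> real^3)" for i
    unfolding linear_conv_bounded_linear[symmetric] by (simp add: linear_iff column_def vec_eq_iff)
  have "smooth_on U w"
    unfolding w_def using tmb
    by (intro smooth_on_bilinear[OF open_U bounded_bilinear_cross3] smooth_on_bounded_linear[OF open_U col])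
      (simp_all add: tangent_moving_basis_def)
  moreover have "w q \<noteq> 0" if "q \<in> U" for q
    using tmb that unfolding w_def by (intro cross3_columns_nonzero) (auto simp: tangent_moving_basis_def)
  ultimately have "smooth_on U (\<lambda>q. inverse (sqrt (w q \<bullet> w q)) *\<^sub>R w q)"
    by (intro smooth_intros smooth_on_inverse smooth_on_sqrt open_U) auto
  also have "(\<lambda>q. inverse (sqrt (w q \<bullet> w q)) *\<^sub>R w q) = n"
    by (simp add: fun_eq_iff induced_normal_def w_def norm_eq_sqrt_inner Let_def)
  finally show ?thesis .
qed

lemma x_deriv: "q \<in> U \<Longrightarrow> (x has_derivative Dx q) (at q)"
  by (rule smooth_on_imp_has_derivative[OF smooth_x])

lemma n_deriv: "q \<in> U \<Longrightarrow> (n has_derivative Dn q) (at q)"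
  by (rule smooth_on_imp_has_derivative[OF smooth_n])

lemma linear_Dx: "q \<in> U \<Longrightarrow> linear (Dx q)" and linear_Dn: "q \<in> U \<Longrightarrow> linear (Dn q)"
  using x_deriv n_deriv has_derivative_linear by blast+

lemma norm_n: "q \<in> U \<Longrightarrow> norm (n q) = 1"
  using tmb cross3_columns_nonzero by (simp add: induced_normal_def Let_def tangent_moving_basis_def)

lemma n_orthogonal_Dx:
  assumes "q \<in> U"
  shows "n q \<bullet> Dx q w = 0"
proof -
  have "n q \<bullet> Dx q (axis i 1) = 0" if "Dx q (axis i 1) \<in> span {column 1 (\<Omega> q), column 2 (\<Omega> q)}" for i
  proof -
    have "orthogonal (n q) (Dx q (axis i 1))"
      by (rule orthogonal_to_span[OF that])
        (auto simp: orthogonal_def induced_normal_def Let_def dot_cross_self)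
    then show ?thesis by (simp add: orthogonal_def)
  qed
  then have "n q \<bullet> Dx q (axis 1 1) = 0" "n q \<bullet> Dx q (axis 2 1) = 0"
    using tmb assms by (auto simp: tangent_moving_basis_def column_jacobian)
  then show ?thesis
    by (simp add: linear_real2_expand[OF linear_Dx[OF assms], of w] inner_add_right)
qed

lemma n_orthogonal_Dn:
  assumes "q \<in> U"
  shows "n q \<bullet> Dn q w = 0"
proof -
  have "((\<lambda>q. n q \<bullet> n q) has_derivative (\<lambda>w. n q \<bullet> Dn q w + Dn q w \<bullet> n q)) (at q)"
    by (intro has_derivative_inner n_deriv assms)
  then have "n q \<bullet> Dn q w + Dn q w \<bullet> n q = 0"
    by (rule derivative_of_locally_constant[where c = 1, OF _ open_U assms]) (use norm_n in \<open>simp add: norm_eq_1\<close>)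
  then show ?thesis by (simp add: inner_commute)
qed

text \<open>Differentiating \<open>n \<bullet> Dx u = 0\<close> in the direction \<open>v\<close> gives \<open>Dx u \<bullet> Dn v = - n \<bullet> D\<^sup>2x(u, v)\<close>, which is
  symmetric.\<close>

lemma second_form_symmetric:
  assumes "q \<in> U"
  shows "Dx q u \<bullet> Dn q v = Dx q v \<bullet> Dn q u"
proof -
  let ?D2 = "\<lambda>u v. frechet_derivative (\<lambda>q. Dx q u) (at q) v"
  have D2: "((\<lambda>q. Dx q u) has_derivative ?D2 u) (at q)" for u
    by (rule smooth_on_imp_has_derivative[OF smooth_on_frechet_derivative[OF smooth_x] assms])
  have *: "n q \<bullet> ?D2 u v + Dn q v \<bullet> Dx q u = 0" for u v
  proof -
    have "((\<lambda>q. n q \<bullet> Dx q u) has_derivative (\<lambda>v. n q \<bullet> ?D2 u v + Dn q v \<bullet> Dx q u)) (at q)"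
      by (intro has_derivative_inner n_deriv D2 assms)
    then show ?thesis
      by (rule derivative_of_locally_constant[where c = 0, OF _ open_U assms]) (rule n_orthogonal_Dx)
  qed
  have "?D2 u v \<bullet> b = ?D2 v u \<bullet> b" for b
  proof -
    have comp: "frechet_derivative (\<lambda>q. g q \<bullet> b) (at q) = (\<lambda>v. frechet_derivative g (at q) v \<bullet> b)"
      if "smooth_on U g" "q \<in> U" for g :: "real^2 \<Rightarrow> real^3" and q
      by (rule frechet_derivative_at[symmetric])
        (rule has_derivative_inner_left[OF smooth_on_imp_has_derivative[OF that]])
    have D: "frechet_derivative (\<lambda>q. frechet_derivative (\<lambda>q. x q \<bullet> b) (at q) u) (at q) v = ?D2 u v \<bullet> b" for u v
    proof -
      have "((\<lambda>q. frechet_derivative (\<lambda>q. x q \<bullet> b) (at q) u) has_derivative (\<lambda>v. ?D2 u v \<bullet> b)) (at q)"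
        by (rule has_derivative_transform_within_open[OF has_derivative_inner_left[OF D2] open_U assms])
          (simp add: comp[OF smooth_x])
      from frechet_derivative_at[OF this] show ?thesis by metis
    qed
    have "smooth_on U (\<lambda>q. x q \<bullet> b)"
      by (intro smooth_intros smooth_x open_U)
    then have "Ck_on (Suc (Suc 0)) U (\<lambda>q. x q \<bullet> b)" unfolding smooth_on_def by blast
    from second_derivative_symmetric[OF open_U this assms, of u v] show ?thesis by (simp only: D)
  qed
  then have "\<forall>b. ?D2 u v \<bullet> b = ?D2 v u \<bullet> b" by blast
  then have "?D2 u v = ?D2 v u" unfolding vector_eq_rdot .
  then show ?thesis using *[of u v] *[of v u] by (simp add: inner_commute)
qed

text \<open>The regular points of a proper frontal are dense, so identities between continuous maps may be
  checked at regular points only.\<close>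

lemma eq_zero_on_dense_regular:
  fixes F :: "real^2 \<Rightarrow> 'b::real_normed_vector"
  assumes "open V" "V \<subseteq> U" "continuous_on V F" "\<And>q. q \<in> V - singularities U x \<Longrightarrow> F q = 0" "q \<in> V"
  shows "F q = 0"
proof (rule ccontr)
  assume "F q \<noteq> 0"
  have "open (V \<inter> F -` (- {0}))"
    by (rule continuous_open_preimage[OF assms(3,1)]) auto
  moreover have "V \<inter> F -` (- {0}) \<subseteq> singularities U x" using assms(4) by auto
  ultimately have "V \<inter> F -` (- {0}) \<subseteq> interior (singularities U x)" by (rule interior_maximal[rotated])
  moreover have "q \<in> V \<inter> F -` (- {0})" using \<open>F q \<noteq> 0\<close> assms(5) by simp
  ultimately have "q \<in> interior (singularities U x)" by (rule subsetD)
  then show False using proper by (simp add: proper_frontal_def)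
qed

lemma cross3_partials_regular:
  assumes "q \<in> U" "q \<notin> singularities U x"
  shows "cross3 (Dx q (axis 1 1)) (Dx q (axis 2 1)) \<noteq> 0"
proof
  assume eq: "cross3 (Dx q (axis 1 1)) (Dx q (axis 2 1)) = 0"
  have inj: "inj (Dx q)" using assms by (simp add: singularities_def immersive_at_def)
  have ax: "axis 1 1 \<noteq> (0 :: real^2)" "axis 2 1 \<noteq> (0 :: real^2)" by (simp_all add: axis_eq_0_iff)
  have ker: "\<forall>w. Dx q w = 0 \<longrightarrow> w = 0"
    using inj unfolding linear_injective_0[OF linear_Dx[OF assms(1)]] .
  from eq have "collinear {0, Dx q (axis 1 1), Dx q (axis 2 1)}" by (simp add: cross_eq_0)
  then consider "Dx q (axis 1 1) = 0" | "Dx q (axis 2 1) = 0" | c where "Dx q (axis 2 1) = c *\<^sub>R Dx q (axis 1 1)"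
    unfolding collinear_lemma by blast
  then show False
  proof cases
    case 3
    then have "Dx q (axis 2 1 - c *\<^sub>R axis 1 1) = 0"
      using linear_Dx[OF assms(1)] by (simp add: linear_diff linear_cmul)
    then have "axis 2 1 - c *\<^sub>R axis 1 1 = (0 :: real^2)" by (rule ker[rule_format])
    then have "(axis 2 1 - c *\<^sub>R axis 1 1 :: real^2) $ 2 = 0" by simp
    then show ?thesis by (simp add: axis_def)
  qed (use ker ax in auto)
qed

text \<open>At regular points this is the definition of the Gaussian curvature, because both cross products are multiples
  of \<open>n\<close>; density of the regular points extends it to the singular set.\<close>

lemma curvature_relation:
  assumes "q \<in> U"
  shows "cross3 (Dn q (axis 1 1)) (Dn q (axis 2 1)) = \<kappa> q *\<^sub>R cross3 (Dx q (axis 1 1)) (Dx q (axis 2 1))"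
proof -
  let ?X = "\<lambda>q. cross3 (Dx q (axis 1 1)) (Dx q (axis 2 1))" and ?N = "\<lambda>q. cross3 (Dn q (axis 1 1)) (Dn q (axis 2 1))"
  have "?N q - \<kappa> q *\<^sub>R ?X q = 0"
  proof (rule eq_zero_on_dense_regular[OF open_U subset_refl _ _ assms])
    have "smooth_on U \<kappa>" using ext by (simp add: gaussian_curvature_extension_def)
    then have "smooth_on U (\<lambda>q. ?N q - \<kappa> q *\<^sub>R ?X q)"
      by (intro smooth_intros smooth_on_bilinear[OF _ bounded_bilinear_cross3] smooth_on_frechet_derivative
          smooth_x smooth_n open_U)
    then show "continuous_on U (\<lambda>q. ?N q - \<kappa> q *\<^sub>R ?X q)" by (rule smooth_on_imp_continuous_on)
    fix q assume q: "q \<in> U - singularities U x"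
    have X: "?X q = (n q \<bullet> ?X q) *\<^sub>R n q" and N: "?N q = (n q \<bullet> ?N q) *\<^sub>R n q"
      using q by (intro cross3_of_orthogonal_to_unit norm_n n_orthogonal_Dx n_orthogonal_Dn; simp)+
    have "?X q \<noteq> 0" using q by (intro cross3_partials_regular) auto
    then have X0: "n q \<bullet> ?X q \<noteq> 0" using X by auto
    have "\<kappa> q = (?X q \<bullet> ?N q) / (?X q \<bullet> ?X q)"
    proof -
      have "det (- B) = det B" for B :: "real^2^2" by (simp add: det_2)
      then show ?thesis
        using ext q by (simp add: gaussian_curvature_extension_def gaussian_curvature_def
            first_form_def second_form_def det_transpose_mul_columns column_jacobian)
    qed
    also have "\<dots> = (n q \<bullet> ?N q) / (n q \<bullet> ?X q)"
      using norm_n[of q] q X0 by (subst (1 2 3) X, subst N) (simp add: norm_eq_1)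
    finally have "(n q \<bullet> ?N q) = \<kappa> q * (n q \<bullet> ?X q)" using X0 by simp
    then show "?N q - \<kappa> q *\<^sub>R ?X q = 0" by (subst N, subst X) simp
  qed
  then show ?thesis by simp
qed

text \<open>The wavefront condition concerns some local unit normal \<open>m\<close>, not the induced normal \<open>n\<close>. At regular points both
  are orthogonal to the tangent plane, so \<open>m = c n\<close> with \<open>c\<^sup>2 = 1\<close>, and by density this holds at singular points
  too. Then \<open>c\<close> has zero derivative, and a common kernel vector of \<open>Dx\<close> and \<open>Dn\<close> is one of \<open>Dm\<close>.\<close>

lemma wavefront_kernel:
  assumes "p \<in> U" "Dx p w = 0" "Dn p w = 0"
  shows "w = 0"
proof -
  obtain V m where V: "open V" "p \<in> V" "V \<subseteq> U" and m: "unit_normal_field V x m"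
    and imm: "immersive_at (\<lambda>q. (x q, m q)) p"
    using wf assms(1) unfolding wavefront_def by blast
  have smooth_m: "smooth_on V m" and norm_m: "\<And>q. q \<in> V \<Longrightarrow> norm (m q) = 1"
    and m_orth: "\<And>q. q \<in> V \<Longrightarrow> m q \<bullet> Dx q (axis 1 1) = 0" "\<And>q. q \<in> V \<Longrightarrow> m q \<bullet> Dx q (axis 2 1) = 0"
    using m by (auto simp: unit_normal_field_def orthogonal_def column_jacobian)
  define c where "c q = m q \<bullet> n q" for q
  have smooth_c: "smooth_on V c"
    unfolding c_def by (intro smooth_intros smooth_m smooth_on_subset[OF smooth_n V(3)] V(1))
  have m_eq: "m q = c q *\<^sub>R n q" if "q \<in> V" for q
  proof -
    have "m q - c q *\<^sub>R n q = 0"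
    proof (rule eq_zero_on_dense_regular[OF V(1,3) _ _ that])
      show "continuous_on V (\<lambda>q. m q - c q *\<^sub>R n q)"
        by (intro smooth_on_imp_continuous_on smooth_intros smooth_m smooth_c smooth_on_subset[OF smooth_n V(3)] V(1))
      fix q assume q: "q \<in> V - singularities U x"
      let ?X = "cross3 (Dx q (axis 1 1)) (Dx q (axis 2 1))"
      have "q \<in> U" using q V(3) by blast
      have "?X \<noteq> 0" using q \<open>q \<in> U\<close> by (intro cross3_partials_regular) auto
      have Xn: "?X = (n q \<bullet> ?X) *\<^sub>R n q"
        by (intro cross3_of_orthogonal_to_unit norm_n n_orthogonal_Dx \<open>q \<in> U\<close>)
      have Xm: "?X = (m q \<bullet> ?X) *\<^sub>R m q"
        using q by (intro cross3_of_orthogonal_to_unit norm_m m_orth) auto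
      have "m q \<bullet> ?X \<noteq> 0" using Xm \<open>?X \<noteq> 0\<close> by auto
      have "(m q \<bullet> ?X) *\<^sub>R m q = (n q \<bullet> ?X) *\<^sub>R n q" using Xm Xn by simp
      then have "m q = ((n q \<bullet> ?X) / (m q \<bullet> ?X)) *\<^sub>R n q"
        using \<open>m q \<bullet> ?X \<noteq> 0\<close> by (simp add: eq_vector_fraction_iff)
      then obtain t where t: "m q = t *\<^sub>R n q" by blast
      then have "c q = t" using norm_n[OF \<open>q \<in> U\<close>] by (simp add: c_def norm_eq_1)
      with t show "m q - c q *\<^sub>R n q = 0" by simp
    qed
    then show ?thesis by simp
  qed
  have c_sq: "c q * c q = 1" if "q \<in> V" for q
  proof -
    have "m q \<bullet> m q = c q * c q" using m_eq[OF that] norm_n[of q] that V(3) by (auto simp: norm_eq_1)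
    then show ?thesis using norm_m[OF that] by (simp add: norm_eq_1)
  qed
  note dc = smooth_on_imp_has_derivative[OF smooth_c V(2)]
  have "frechet_derivative c (at p) w = 0"
  proof -
    have "((\<lambda>q. c q * c q) has_derivative (\<lambda>w. c p * frechet_derivative c (at p) w + frechet_derivative c (at p) w * c p)) (at p)"
      by (intro has_derivative_mult dc)
    then have "c p * frechet_derivative c (at p) w + frechet_derivative c (at p) w * c p = 0"
      by (rule derivative_of_locally_constant[where c = 1, OF _ V(1,2)]) (rule c_sq)
    moreover have "c p \<noteq> 0" using c_sq[OF V(2)] by auto
    ultimately show ?thesis by (simp add: mult.commute)
  qed
  moreover have "(m has_derivative (\<lambda>w. c p *\<^sub>R Dn p w + frechet_derivative c (at p) w *\<^sub>R n p)) (at p)"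
    by (rule has_derivative_transform_within_open[OF has_derivative_scaleR[OF dc n_deriv[OF assms(1)]] V(1,2)])
      (simp add: m_eq)
  then have "((\<lambda>q. (x q, m q)) has_derivative
      (\<lambda>w. (Dx p w, c p *\<^sub>R Dn p w + frechet_derivative c (at p) w *\<^sub>R n p))) (at p)"
    by (intro has_derivative_Pair x_deriv assms(1))
  note D = this frechet_derivative_at[OF this]
  ultimately have "frechet_derivative (\<lambda>q. (x q, m q)) (at p) w = 0"
    using fun_cong[OF D(2), of w] assms(2,3) by (simp add: zero_prod_def)
  moreover have "linear (frechet_derivative (\<lambda>q. (x q, m q)) (at p))"
    unfolding D(2)[symmetric] by (rule has_derivative_linear[OF D(1)])
  ultimately show ?thesis
    using imm linear_injective_0 unfolding immersive_at_def by blast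
qed

text \<open>For \<open>\<sigma> = 1\<close> and \<open>\<sigma> = - 1\<close> these are the two linear factors of the equation of asymptotic
  directions.\<close>

definition asymptotic_form where
  "asymptotic_form \<sigma> q w = Dn q w - (\<sigma> * sqrt (- \<kappa> q)) *\<^sub>R cross3 (n q) (Dx q w)"

lemma linear_asymptotic_form:
  assumes "q \<in> U"
  shows "linear (asymptotic_form \<sigma> q)"
proof -
  have "linear (\<lambda>w. Dn q w - (\<sigma> * sqrt (- \<kappa> q)) *\<^sub>R cross3 (n q) (Dx q w))"
    using linear_Dx[OF assms] linear_Dn[OF assms]
    by (simp add: linear_iff cross_add_right cross_mult_right algebra_simps)
  then show ?thesis unfolding asymptotic_form_def[abs_def] .
qed

lemma smooth_asymptotic_form: "smooth_on U (\<lambda>q. asymptotic_form \<sigma> q w)"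
proof -
  have "smooth_on U \<kappa>" using ext by (simp add: gaussian_curvature_extension_def)
  then show ?thesis
    unfolding asymptotic_form_def
    by (intro smooth_intros smooth_on_sqrt smooth_on_bilinear[OF _ bounded_bilinear_cross3]
        smooth_on_frechet_derivative smooth_x smooth_n open_U) (use neg in auto)
qed

lemma asymptotic_form_rank:
  assumes "q \<in> U" "\<sigma>\<^sup>2 = 1"
  shows "cross3 (asymptotic_form \<sigma> q (axis 1 1)) (asymptotic_form \<sigma> q (axis 2 1)) = 0"
  unfolding asymptotic_form_def
proof (rule rotated_difference_dependent)
  have "(\<sigma> * sqrt (- \<kappa> q))\<^sup>2 = - \<kappa> q"
    using assms neg by (simp add: power_mult_distrib less_imp_le)
  then show "cross3 (Dn q (axis 1 1)) (Dn q (axis 2 1)) =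
      - (\<sigma> * sqrt (- \<kappa> q))\<^sup>2 *\<^sub>R cross3 (Dx q (axis 1 1)) (Dx q (axis 2 1))"
    using curvature_relation[OF assms(1)] by simp
qed (use assms norm_n n_orthogonal_Dx n_orthogonal_Dn second_form_symmetric in auto)

lemma asymptotic_form_kernel:
  assumes "asymptotic_form \<sigma> q w = 0"
  shows "Dx q w \<bullet> Dn q w = 0"
proof -
  have "Dn q w = (\<sigma> * sqrt (- \<kappa> q)) *\<^sub>R cross3 (n q) (Dx q w)"
    using assms by (simp add: asymptotic_form_def)
  then show ?thesis by (simp add: dot_cross_self)
qed

text \<open>The sum of the two equations gives \<open>Dn w = 0\<close>; their difference gives \<open>n \<times> Dx w = 0\<close>, because \<open>\<kappa>\<close> is
  non-zero, and so \<open>Dx w = 0\<close>.\<close>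

lemma asymptotic_forms_independent:
  assumes "p \<in> U" "asymptotic_form 1 p w = 0" "asymptotic_form (-1) p w = 0"
  shows "w = 0"
proof (rule wavefront_kernel[OF assms(1)])
  have eq: "Dn p w = sqrt (- \<kappa> p) *\<^sub>R cross3 (n p) (Dx p w)"
    using assms(2) by (simp add: asymptotic_form_def)
  have "Dn p w + sqrt (- \<kappa> p) *\<^sub>R cross3 (n p) (Dx p w) = 0"
    using assms(3) by (simp add: asymptotic_form_def)
  then have "2 *\<^sub>R Dn p w = 0" unfolding eq[symmetric] by (simp only: scaleR_2)
  then show "Dn p w = 0" by simp
  have "sqrt (- \<kappa> p) \<noteq> 0" using neg assms(1) by auto
  then have "cross3 (n p) (Dx p w) = 0" using eq \<open>Dn p w = 0\<close> by simp
  moreover have "n p \<noteq> 0" using norm_n[OF assms(1)] by auto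
  ultimately show "Dx p w = 0"
    using cross_dot_cancel[of "n p" "Dx p w" 0] n_orthogonal_Dx[OF assms(1)] by simp
qed

text \<open>On a kernel vector of \<open>Dx\<close> the form reduces to \<open>Dn\<close>, which does not vanish there.\<close>

lemma asymptotic_form_nonzero:
  assumes "p \<in> singularities U x"
  obtains w where "asymptotic_form \<sigma> p w \<noteq> 0"
proof -
  have "p \<in> U" "\<not> inj (Dx p)"
    using assms x_deriv by (auto simp: singularities_def immersive_at_def differentiable_def)
  then obtain k where "Dx p k = 0" "k \<noteq> 0"
    using linear_injective_0[OF linear_Dx] by blast
  then have "Dn p k \<noteq> 0" using wavefront_kernel[OF \<open>p \<in> U\<close>] by blast
  then have "asymptotic_form \<sigma> p k \<noteq> 0" using \<open>Dx p k = 0\<close> by (simp add: asymptotic_form_def)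
  then show thesis by (rule that)
qed

text \<open>Near \<open>p\<close> the kernel of the vector-valued form coincides with that of its component \<open>\<alpha>\<close> along a value taken at
  \<open>p\<close>, so a first integral of the covector field \<open>\<alpha>\<close> is what is needed.\<close>

lemma asymptotic_first_integral:
  assumes "p \<in> singularities U x" "\<sigma>\<^sup>2 = 1"
  obtains V and h :: "real^2 \<Rightarrow> real" where "open V" "p \<in> V" "V \<subseteq> U" "smooth_on V h"
    "\<forall>q\<in>V. \<forall>w. frechet_derivative h (at q) w = 0 \<longrightarrow> asymptotic_form \<sigma> q w = 0"
proof -
  have "p \<in> U" using assms(1) by (simp add: singularities_def)
  obtain w\<^sub>0 where w\<^sub>0: "asymptotic_form \<sigma> p w\<^sub>0 \<noteq> 0" by (rule asymptotic_form_nonzero[OF assms(1)])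
  define a where "a = asymptotic_form \<sigma> p w\<^sub>0"
  define \<alpha> where "\<alpha> q = (vector [asymptotic_form \<sigma> q (axis 1 1) \<bullet> a, asymptotic_form \<sigma> q (axis 2 1) \<bullet> a] :: real^2)" for q
  have \<alpha>: "\<alpha> q \<bullet> w = asymptotic_form \<sigma> q w \<bullet> a" if "q \<in> U" for q w
  proof -
    have "vector [s, t] \<bullet> w = s * w $ 1 + t * w $ 2" for s t by (simp add: inner_vec_def sum_2)
    then show ?thesis
      by (simp add: \<alpha>_def linear_real2_expand[OF linear_asymptotic_form[OF that], of \<sigma> w]
          inner_add_left mult.commute)
  qed
  have "\<alpha> = (\<lambda>q. (asymptotic_form \<sigma> q (axis 1 1) \<bullet> a) *\<^sub>R axis 1 1 + (asymptotic_form \<sigma> q (axis 2 1) \<bullet> a) *\<^sub>R axis 2 1)"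
    by (simp add: fun_eq_iff \<alpha>_def vec_eq_iff forall_2 axis_def)
  then have smooth_\<alpha>: "smooth_on U \<alpha>"
    by (simp only:) (intro smooth_intros smooth_asymptotic_form open_U)
  define U' where "U' = U \<inter> \<alpha> -` (- {0})"
  have "open U'"
    unfolding U'_def by (rule continuous_open_preimage[OF smooth_on_imp_continuous_on[OF smooth_\<alpha>] open_U]) auto
  have "\<alpha> p \<bullet> w\<^sub>0 \<noteq> 0" using w\<^sub>0 by (simp add: \<alpha>[OF \<open>p \<in> U\<close>] a_def)
  then have "\<alpha> p \<noteq> 0" by auto
  then have "p \<in> U'" using \<open>p \<in> U\<close> by (simp add: U'_def)
  have "smooth_on U' \<alpha>" by (rule smooth_on_subset[OF smooth_\<alpha>]) (simp add: U'_def)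
  from first_integral_of_covector_field[OF \<open>open U'\<close> this \<open>p \<in> U'\<close> \<open>\<alpha> p \<noteq> 0\<close>]
  obtain V and h :: "real^2 \<Rightarrow> real" where V: "open V" "p \<in> V" "V \<subseteq> U'" "smooth_on V h"
    and h: "\<And>q w. q \<in> V \<Longrightarrow> frechet_derivative h (at q) w = 0 \<Longrightarrow> \<alpha> q \<bullet> w = 0" by metis
  show thesis
  proof (rule that[OF V(1,2) _ V(4)])
    show "V \<subseteq> U" using V(3) by (auto simp: U'_def)
    have "asymptotic_form \<sigma> q w = 0" if "q \<in> V" "frechet_derivative h (at q) w = 0" for q w
    proof -
      from that have "\<alpha> q \<bullet> w = 0" "\<alpha> q \<bullet> \<alpha> q \<noteq> 0" "q \<in> U"
        using h V(3) by (auto simp: U'_def)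
      then show ?thesis
        by (intro kernel_of_rank_one[OF linear_asymptotic_form asymptotic_form_rank, where a = a and w' = "\<alpha> q"])
          (simp_all add: \<alpha> assms(2))
    qed
    then show "\<forall>q\<in>V. \<forall>w. frechet_derivative h (at q) w = 0 \<longrightarrow> asymptotic_form \<sigma> q w = 0" by blast
  qed
qed

text \<open>A curve on which \<open>h\<close> is constant has its velocity in the kernel of \<open>Dh\<close>, hence in an asymptotic
  direction.\<close>

lemma level_curve_G_asymptotic:
  assumes V: "V \<subseteq> U" "smooth_on V h"
    and ker: "\<forall>q\<in>V. \<forall>w. frechet_derivative h (at q) w = 0 \<longrightarrow> asymptotic_form \<sigma> q w = 0"
    and J: "open_interval J" and \<gamma>: "smooth_on J \<gamma>" "\<gamma> ` J \<subseteq> V" "\<And>s. s \<in> J \<Longrightarrow> h (\<gamma> s) = (c::real)"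
  shows "G_asymptotic U x \<Omega> J \<gamma>"
  unfolding G_asymptotic_def
proof (intro conjI ballI J \<gamma>(1))
  show "\<gamma> ` J \<subseteq> U" using \<gamma>(2) V(1) by blast
  fix s assume s: "s \<in> J"
  have "open J" using J by (simp add: open_interval_def)
  define v where "v = vector_derivative \<gamma> (at s)"
  note d\<gamma> = smooth_on_imp_has_derivative[OF \<gamma>(1) s]
  have v: "frechet_derivative \<gamma> (at s) 1 = v"
    using frechet_derivative_eq_vector_derivative[of \<gamma> s] d\<gamma> by (simp add: v_def differentiable_def exI)
  have q: "\<gamma> s \<in> V" "\<gamma> s \<in> U" using s \<gamma>(2) V(1) by blast+
  have "((\<lambda>s. h (\<gamma> s)) has_derivative (\<lambda>t. frechet_derivative h (at (\<gamma> s)) (frechet_derivative \<gamma> (at s) t))) (at s)"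
    by (rule has_derivative_compose[OF d\<gamma> smooth_on_imp_has_derivative[OF V(2) q(1)]])
  then have "frechet_derivative h (at (\<gamma> s)) (frechet_derivative \<gamma> (at s) 1) = 0"
    by (rule derivative_of_locally_constant[where c = c, OF _ \<open>open J\<close> s]) (rule \<gamma>(3))
  then have "asymptotic_form \<sigma> (\<gamma> s) v = 0" unfolding v using ker q(1) by blast
  then have "Dx (\<gamma> s) v \<bullet> Dn (\<gamma> s) v = 0" by (rule asymptotic_form_kernel)
  moreover have "Dx (\<gamma> s) v = jacobian x (at (\<gamma> s)) *v v" "Dn (\<gamma> s) v = jacobian n (at (\<gamma> s)) *v v"
    using fun_cong[OF matrix_vector_mul(2)[OF linear_Dx[OF q(2)]], of v]
      fun_cong[OF matrix_vector_mul(2)[OF linear_Dn[OF q(2)]], of v] by (simp_all add: jacobian_def)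
  moreover have pullback: "v \<bullet> (transpose A ** B *v v) = (A *v v) \<bullet> (B *v v)" for A B :: "real^2^3"
    unfolding matrix_vector_mul_assoc[symmetric] dot_lmul_matrix[symmetric] vector_transpose_matrix ..
  moreover have minus_mult: "(- B) *v v = - (B *v v)" for B :: "real^2^2"
    by (simp add: matrix_vector_mult_def vec_eq_iff sum_negf)
  ultimately have "v \<bullet> (second_form x \<Omega> (\<gamma> s) *v v) = 0"
    unfolding second_form_def minus_mult inner_minus_right pullback by simp
  then show "vector_derivative \<gamma> (at s) \<bullet> (second_form x \<Omega> (\<gamma> s) *v vector_derivative \<gamma> (at s)) = 0"
    by (simp add: v_def)
qed

end

section \<open>Asymptotic coordinates\<close>

theorem theorem5p2:
  fixes U :: "(real^2) set"
    and x :: "real^2 \<Rightarrow> real^3"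
    and \<Omega> :: "real^2 \<Rightarrow> real^2^3"
    and \<kappa> :: "real^2 \<Rightarrow> real"
  assumes "open U"
    and "wavefront U x"
    and "proper_frontal U x"
    and "tangent_moving_basis U x \<Omega>"
    and "gaussian_curvature_extension U x \<Omega> \<kappa>"
    and "\<forall>q\<in>U. \<kappa> q < 0"
  shows "\<forall>p \<in> singularities U x.
           \<exists>U\<^sub>1 U\<^sub>2 t. open U\<^sub>1 \<and> open U\<^sub>2 \<and> p \<in> U\<^sub>2 \<and> U\<^sub>2 \<subseteq> U \<and>
             diffeomorphism U\<^sub>1 U\<^sub>2 t \<and> coordinate_curves_G_asymptotic U x \<Omega> U\<^sub>1 t"
proof
  fix p assume p: "p \<in> singularities U x"
  interpret negative_wavefront U x \<Omega> \<kappa> using assms by unfold_locales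
  have "p \<in> U" using p by (simp add: singularities_def)
  obtain V\<^sub>1 and h\<^sub>1 :: "real^2 \<Rightarrow> real" where V\<^sub>1: "open V\<^sub>1" "p \<in> V\<^sub>1" "V\<^sub>1 \<subseteq> U" "smooth_on V\<^sub>1 h\<^sub>1"
    and h\<^sub>1: "\<forall>q\<in>V\<^sub>1. \<forall>w. frechet_derivative h\<^sub>1 (at q) w = 0 \<longrightarrow> asymptotic_form 1 q w = 0"
    by (rule asymptotic_first_integral[OF p one_power2])
  obtain V\<^sub>2 and h\<^sub>2 :: "real^2 \<Rightarrow> real" where V\<^sub>2: "open V\<^sub>2" "p \<in> V\<^sub>2" "V\<^sub>2 \<subseteq> U" "smooth_on V\<^sub>2 h\<^sub>2"
    and h\<^sub>2: "\<forall>q\<in>V\<^sub>2. \<forall>w. frechet_derivative h\<^sub>2 (at q) w = 0 \<longrightarrow> asymptotic_form (-1) q w = 0"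
    by (rule asymptotic_first_integral[OF p, of "-1"]) simp
  define V where "V = V\<^sub>1 \<inter> V\<^sub>2"
  have V: "open V" "p \<in> V" "V \<subseteq> U" using V\<^sub>1 V\<^sub>2 by (auto simp: V_def)
  have smooth_h: "smooth_on V h\<^sub>1" "smooth_on V h\<^sub>2"
    using V\<^sub>1(4) V\<^sub>2(4) by (auto simp: V_def intro: smooth_on_subset)
  define H :: "real^2 \<Rightarrow> real^2" where "H q = h\<^sub>1 q *\<^sub>R axis 1 1 + h\<^sub>2 q *\<^sub>R axis 2 1" for q
  have H: "H q $ 1 = h\<^sub>1 q" "H q $ 2 = h\<^sub>2 q" for q
    by (simp_all add: H_def axis_def)
  have smooth_H: "smooth_on V H"
    unfolding H_def by (intro smooth_intros smooth_h V(1))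
  have inj: "inj (frechet_derivative H (at p))"
  proof (subst linear_injective_0)
    note dH = smooth_on_imp_has_derivative[OF smooth_H V(2)]
    show "linear (frechet_derivative H (at p))" by (rule has_derivative_linear[OF dH])
    have comp: "frechet_derivative (\<lambda>q. H q $ i) (at p) w = frechet_derivative H (at p) w $ i" for i w
      using frechet_derivative_at[OF bounded_linear.has_derivative[OF bounded_linear_vec_nth dH, of i]]
      by (simp add: fun_eq_iff)
    have "w = 0" if "frechet_derivative H (at p) w = 0" for w
      using comp[of 1 w] comp[of 2 w] that h\<^sub>1 V\<^sub>1(2) h\<^sub>2 V\<^sub>2(2)
        asymptotic_forms_independent[OF \<open>p \<in> U\<close>, of w] by (simp add: H)
    then show "\<forall>w. frechet_derivative H (at p) w = 0 \<longrightarrow> w = 0" by blast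
  qed
  obtain U\<^sub>2 U\<^sub>1 t where U: "open U\<^sub>2" "p \<in> U\<^sub>2" "U\<^sub>2 \<subseteq> V" "open U\<^sub>1"
    and hom: "homeomorphism U\<^sub>2 U\<^sub>1 H t" and t: "smooth_on U\<^sub>1 t"
    by (rule smooth_inverse_function[OF V(1) smooth_H V(2) inj])
  have Ht: "t z \<in> U\<^sub>2" "H (t z) = z" if "z \<in> U\<^sub>1" for z
    using hom that by (auto simp: homeomorphism_def)
  have bij: "bij_betw t U\<^sub>1 U\<^sub>2"
    using hom by (intro bij_betw_byWitness[where f' = H]) (auto simp: homeomorphism_def)
  have "inv_into U\<^sub>1 t q = H q" if "q \<in> U\<^sub>2" for q
    using hom that bij by (intro inv_into_f_eq) (auto simp: homeomorphism_def bij_betw_def)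
  then have "smooth_on U\<^sub>2 (inv_into U\<^sub>1 t)"
    using smooth_on_subset[OF smooth_H U(3)] smooth_on_cong[OF U(1)] by metis
  then have diffeo: "diffeomorphism U\<^sub>1 U\<^sub>2 t"
    unfolding diffeomorphism_def using bij t by blast
  have line: "smooth_on J (\<lambda>s. t (l s))"
    if "open_interval J" "\<forall>s\<in>J. l s \<in> U\<^sub>1" "l = (\<lambda>s. a + s *\<^sub>R b)" for J l and a b :: "real^2"
  proof (rule smooth_on_compose[OF _ _ t])
    show "open J" using that(1) by (simp add: open_interval_def)
    then show "smooth_on J l" unfolding that(3) by (intro smooth_intros)
  qed (use that(2) in auto)
  have "coordinate_curves_G_asymptotic U x \<Omega> U\<^sub>1 t"
    unfolding coordinate_curves_G_asymptotic_def
  proof (intro allI impI conjI)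
    fix J c assume J: "open_interval J"
    {
      assume in_U\<^sub>1: "\<forall>s\<in>J. vector [s, c] \<in> U\<^sub>1"
      show "G_asymptotic U x \<Omega> J (\<lambda>s. t (vector [s, c]))"
      proof (rule level_curve_G_asymptotic[OF V\<^sub>2(3,4) h\<^sub>2 J])
        have "(\<lambda>s. vector [s, c] :: real^2) = (\<lambda>s. c *\<^sub>R axis 2 1 + s *\<^sub>R axis 1 1)"
          by (simp add: fun_eq_iff vec_eq_iff forall_2 axis_def)
        with J in_U\<^sub>1 show "smooth_on J (\<lambda>s. t (vector [s, c]))" by (rule line)
        show "(\<lambda>s. t (vector [s, c])) ` J \<subseteq> V\<^sub>2"
          using Ht(1) in_U\<^sub>1 U(3) by (auto simp: V_def)
        show "h\<^sub>2 (t (vector [s, c])) = c" if "s \<in> J" for s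
          using Ht(2)[of "vector [s, c]"] in_U\<^sub>1 that H(2)[of "t (vector [s, c])"] by simp
      qed
    }
    {
      assume in_U\<^sub>1: "\<forall>s\<in>J. vector [c, s] \<in> U\<^sub>1"
      show "G_asymptotic U x \<Omega> J (\<lambda>s. t (vector [c, s]))"
      proof (rule level_curve_G_asymptotic[OF V\<^sub>1(3,4) h\<^sub>1 J])
        have "(\<lambda>s. vector [c, s] :: real^2) = (\<lambda>s. c *\<^sub>R axis 1 1 + s *\<^sub>R axis 2 1)"
          by (simp add: fun_eq_iff vec_eq_iff forall_2 axis_def)
        with J in_U\<^sub>1 show "smooth_on J (\<lambda>s. t (vector [c, s]))" by (rule line)
        show "(\<lambda>s. t (vector [c, s])) ` J \<subseteq> V\<^sub>1"
          using Ht(1) in_U\<^sub>1 U(3) by (auto simp: V_def)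
        show "h\<^sub>1 (t (vector [c, s])) = c" if "s \<in> J" for s
          using Ht(2)[of "vector [c, s]"] in_U\<^sub>1 that H(1)[of "t (vector [c, s])"] by simp
      qed
    }
  qed
  then show "\<exists>U\<^sub>1 U\<^sub>2 t. open U\<^sub>1 \<and> open U\<^sub>2 \<and> p \<in> U\<^sub>2 \<and> U\<^sub>2 \<subseteq> U \<and>
      diffeomorphism U\<^sub>1 U\<^sub>2 t \<and> coordinate_curves_G_asymptotic U x \<Omega> U\<^sub>1 t"
    using U V(3) diffeo by (metis subset_trans)
qed

end
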